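(* Let $X=Y=\{0,1\}^{\mathbb{N}}$ with shift $\sigma$, and let $c:X\times Y\to\mathbb{R}$ be continuous. For each pair $\mu,\nu\in\mathrm{Fix}_n$ let $\pi(\mu,\nu)$ be any chosen maximizing plan from $\mu$ to $\nu$ for $c$, and for $\beta>0$ and $n\ge1$ let $\zeta_{\beta,n}$ be the probability measure on $X\times Y$ given by $$\zeta_{\beta,n}(w)=\frac{\sum_{\mu,\nu\in\mathrm{Fix}_n}e^{\beta n\int c\,d\pi(\mu,\nu)}\int w\,d\pi(\mu,\nu)}{\sum_{\mu,\nu\in\mathrm{Fix}_n}e^{\beta n\int c\,d\pi(\mu,\nu)}},\qquad w\in C(X\times Y).$$ If $\beta_j\to\infty$, $n_j\to\infty$ and $\zeta_{\beta_j,n_j}\to\pi_\infty$ in the weak* topology, then $\pi_\infty\in\Pi(\sigma)$. Moreover, if $c>0$ on $X\times Y$, then $\pi_\infty$ maximizes the integral of $c$ among the measures in $\Pi(\sigma)$, i.e. $\int c\,d\pi_\infty=\sup_{\pi\in\Pi(\sigma)}\int c\,d\pi$.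
   Context: The shift is $\sigma(x_0,x_1,x_2,\dots)=(x_1,x_2,\dots)$. $C(X\times Y)$ is the set of continuous real-valued functions on $X\times Y$. $\mathrm{Fix}_n$ is the (finite) set of $\sigma$-invariant probability measures on $X=Y$ supported on a periodic orbit of length $n$, i.e. the measures $\frac1n\sum_{i=0}^{n-1}\delta_{\sigma^i(y)}$ with $\sigma^n(y)=y$. A maximizing plan from $\mu$ to $\nu$ for $c$ is a Borel probability measure on $X\times Y$ with $X$-marginal $\mu$ and $Y$-marginal $\nu$ that maximizes $\int c\,d\pi$ among all Borel probability measures $\pi$ with these marginals; no other condition is imposed on the choice. $\Pi(\sigma)$ is the set of Borel probability measures on $X\times Y$ both of whose marginals (on $X$ and on $Y$) are $\sigma$-invariant. *)

theory Defs
  imports "HOL-Probability.Probability"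
begin

text \<open>
  Points of \<open>{0,1}\<^sup>\<nat>\<close>. The topology is the product of the discrete topologies on \<^typ>\<open>bool\<close>,
  supplied by the type class instances for \<^typ>\<open>bool\<close> and for functions.
\<close>

type_synonym bseq = "nat \<Rightarrow> bool"

definition shift :: "bseq \<Rightarrow> bseq" where
  "shift x = (\<lambda>i. x (Suc i))"

definition borel_probs :: "'a::topological_space measure set" where
  "borel_probs = {M. prob_space M \<and> sets M = sets borel}"

definition shift_invariant :: "bseq measure \<Rightarrow> bool" where
  "shift_invariant \<mu> \<longleftrightarrow> distr \<mu> borel shift = \<mu>"

definition invariant_probs :: "bseq measure set" where
  "invariant_probs = {\<mu> \<in> borel_probs. shift_invariant \<mu>}"

text \<open>
  The Borel measure \<open>\<Sum>i\<in>I. a i \<cdot> M i\<close>, intended for finite \<open>I\<close>, nonnegative \<open>a\<close> and Borel measures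
  \<open>M i\<close>; \<open>integral_mixture\<close> below confirms the resulting integrals.
\<close>

definition mixture ::
    "'i set \<Rightarrow> ('i \<Rightarrow> real) \<Rightarrow> ('i \<Rightarrow> 'a::topological_space measure) \<Rightarrow> 'a measure" where
  "mixture I a M =
     measure_of UNIV (sets borel) (\<lambda>A. \<Sum>i\<in>I. ennreal (a i) * emeasure (M i) A)"

definition orbit_measure :: "nat \<Rightarrow> bseq \<Rightarrow> bseq measure" where
  "orbit_measure n y = mixture {..<n} (\<lambda>_. 1 / real n) (\<lambda>i. return borel ((shift ^^ i) y))"

text \<open>The least period of \<open>y\<close> only has to divide \<open>n\<close>.\<close>

definition Fix :: "nat \<Rightarrow> bseq measure set" where
  "Fix n = {orbit_measure n y | y. (shift ^^ n) y = y}"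

definition plans :: "bseq measure \<Rightarrow> bseq measure \<Rightarrow> (bseq \<times> bseq) measure set" where
  "plans \<mu> \<nu> = {\<pi> \<in> borel_probs. distr \<pi> borel fst = \<mu> \<and> distr \<pi> borel snd = \<nu>}"

definition maximizing_plan ::
    "(bseq \<times> bseq \<Rightarrow> real) \<Rightarrow> bseq measure \<Rightarrow> bseq measure \<Rightarrow> (bseq \<times> bseq) measure \<Rightarrow> bool" where
  "maximizing_plan c \<mu> \<nu> \<pi> \<longleftrightarrow>
     \<pi> \<in> plans \<mu> \<nu> \<and> (\<forall>\<rho>\<in>plans \<mu> \<nu>. integral\<^sup>L \<rho> c \<le> integral\<^sup>L \<pi> c)"

definition invariant_plans :: "(bseq \<times> bseq) measure set" where
  "invariant_plans = {\<pi> \<in> borel_probs.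
     distr \<pi> borel fst \<in> invariant_probs \<and> distr \<pi> borel snd \<in> invariant_probs}"

definition weight ::
    "(bseq \<times> bseq \<Rightarrow> real) \<Rightarrow> real \<Rightarrow> nat \<Rightarrow> (bseq \<times> bseq) measure \<Rightarrow> real" where
  "weight c \<beta> n \<pi> = exp (\<beta> * real n * integral\<^sup>L \<pi> c)"

definition zeta ::
    "(bseq \<times> bseq \<Rightarrow> real) \<Rightarrow> (bseq measure \<Rightarrow> bseq measure \<Rightarrow> (bseq \<times> bseq) measure) \<Rightarrow>
     real \<Rightarrow> nat \<Rightarrow> (bseq \<times> bseq) measure" where
  "zeta c P \<beta> n =
     mixture (Fix n \<times> Fix n)
       (\<lambda>(\<mu>, \<nu>). weight c \<beta> n (P \<mu> \<nu>) / (\<Sum>(\<mu>', \<nu>')\<in>Fix n \<times> Fix n. weight c \<beta> n (P \<mu>' \<nu>')))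
       (\<lambda>(\<mu>, \<nu>). P \<mu> \<nu>)"

definition weak_star_tendsto ::
    "(nat \<Rightarrow> (bseq \<times> bseq) measure) \<Rightarrow> (bseq \<times> bseq) measure \<Rightarrow> bool" where
  "weak_star_tendsto M L \<longleftrightarrow>
     (\<forall>w :: bseq \<times> bseq \<Rightarrow> real. continuous_on UNIV w \<longrightarrow>
        (\<lambda>j. integral\<^sup>L (M j) w) \<longlonglongrightarrow> integral\<^sup>L L w)"

instance bool :: second_countable_topology
proof
  have "open = generate_topology (UNIV :: bool set set)"
    by (intro ext) (simp add: Topological_Spaces.open_discrete generate_topology.Basis)
  moreover have "countable (UNIV :: bool set set)" by (simp add: countable_finite)
  ultimately show "\<exists>B :: bool set set. countable B \<and> open = generate_topology B" by blast
qed

lemma sets_mixture [simp]: "sets (mixture I a M) = sets borel"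
  and space_mixture [simp]: "space (mixture I a M) = UNIV"
proof -
  have *: "sigma_algebra (UNIV :: 'a set) (sets borel)"
    using sets.sigma_algebra_axioms[of "borel :: 'a measure"] by simp
  show "sets (mixture I a M) = sets borel" "space (mixture I a M) = UNIV"
    unfolding mixture_def using sigma_algebra.sets_measure_of_eq[OF *] by (auto simp: space_measure_of_conv)
qed

lemma emeasure_mixture:
  fixes M :: "'i \<Rightarrow> 'a::topological_space measure"
  assumes "\<And>i. i \<in> I \<Longrightarrow> sets (M i) = sets borel" and "A \<in> sets borel"
  shows "emeasure (mixture I a M) A = (\<Sum>i\<in>I. ennreal (a i) * emeasure (M i) A)"
proof (rule emeasure_measure_of[OF mixture_def])
  show "countably_additive (sets (mixture I a M)) (\<lambda>A. \<Sum>i\<in>I. ennreal (a i) * emeasure (M i) A)"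
  proof (rule countably_additiveI)
    fix B :: "nat \<Rightarrow> 'a set"
    assume B: "range B \<subseteq> sets (mixture I a M)" "disjoint_family B"
    have "(\<Sum>k. \<Sum>i\<in>I. ennreal (a i) * emeasure (M i) (B k))
        = (\<Sum>i\<in>I. \<Sum>k. ennreal (a i) * emeasure (M i) (B k))"
      by (rule suminf_sum) simp
    also have "\<dots> = (\<Sum>i\<in>I. ennreal (a i) * emeasure (M i) (\<Union> (range B)))"
      using B assms(1) by (intro sum.cong refl) (auto simp: suminf_emeasure)
    finally show "(\<Sum>k. \<Sum>i\<in>I. ennreal (a i) * emeasure (M i) (B k))
        = (\<Sum>i\<in>I. ennreal (a i) * emeasure (M i) (\<Union> (range B)))" .
  qed
qed (use assms(2) in \<open>auto simp: positive_def\<close>)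

lemma nn_integral_mixture:
  assumes M: "\<And>i. i \<in> I \<Longrightarrow> sets (M i) = sets borel" and f: "f \<in> borel_measurable borel"
  shows "nn_integral (mixture I a M) f = (\<Sum>i\<in>I. ennreal (a i) * nn_integral (M i) f)"
  using f
proof (induction f rule: borel_measurable_induct)
  case (cong f g)
  then have "f = g" by auto
  with cong show ?case by simp
next
  case (set A)
  then show ?case
    using M by (simp add: emeasure_mixture)
next
  case (mult u c)
  have [measurable]: "u \<in> borel_measurable N" if "sets N = sets borel" for N
    using mult(2) measurable_cong_sets[OF that refl, of borel] by auto
  have "nn_integral (mixture I a M) (\<lambda>x. c * u x) = c * nn_integral (mixture I a M) u"
    by (intro nn_integral_cmult) simp
  also have "\<dots> = (\<Sum>i\<in>I. ennreal (a i) * (c * nn_integral (M i) u))"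
    by (simp add: mult.IH sum_distrib_left mult_ac)
  also have "\<dots> = (\<Sum>i\<in>I. ennreal (a i) * nn_integral (M i) (\<lambda>x. c * u x))"
    using M by (intro sum.cong refl) (simp add: nn_integral_cmult)
  finally show ?case .
next
  case (add u v)
  have [measurable]: "u \<in> borel_measurable N" "v \<in> borel_measurable N" if "sets N = sets borel" for N
    using add measurable_cong_sets[OF that refl, of borel] by auto
  have "nn_integral (mixture I a M) (\<lambda>x. v x + u x)
      = nn_integral (mixture I a M) v + nn_integral (mixture I a M) u"
    by (intro nn_integral_add) auto
  also have "\<dots> = (\<Sum>i\<in>I. ennreal (a i) * (nn_integral (M i) v + nn_integral (M i) u))"
    by (simp add: add.IH sum.distrib distrib_left)
  also have "\<dots> = (\<Sum>i\<in>I. ennreal (a i) * nn_integral (M i) (\<lambda>x. v x + u x))"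
    using M by (intro sum.cong refl) (simp add: nn_integral_add)
  finally show ?case .
next
  case (seq U)
  have [measurable]: "U k \<in> borel_measurable N" if "sets N = sets borel" for N k
    using seq measurable_cong_sets[OF that refl, of borel] by auto
  have inc: "incseq (\<lambda>k. ennreal (a i) * nn_integral (M i) (U k))" for i
    using seq(3) by (auto simp: incseq_def le_fun_def intro!: mult_left_mono nn_integral_mono)
  have SUP: "(SUP k. U k) = (\<lambda>x. SUP k. U k x)"
    by (auto simp: fun_eq_iff image_image)
  have "nn_integral (mixture I a M) (\<lambda>x. SUP k. U k x) = (SUP k. nn_integral (mixture I a M) (U k))"
    by (intro nn_integral_monotone_convergence_SUP seq) auto
  also have "\<dots> = (SUP k. \<Sum>i\<in>I. ennreal (a i) * nn_integral (M i) (U k))"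
    using seq by simp
  also have "\<dots> = (\<Sum>i\<in>I. SUP k. ennreal (a i) * nn_integral (M i) (U k))"
    by (rule ennreal_SUP_sum) (rule inc)
  also have "\<dots> = (\<Sum>i\<in>I. ennreal (a i) * nn_integral (M i) (\<lambda>x. SUP k. U k x))"
    using M seq by (intro sum.cong refl)
      (simp add: nn_integral_monotone_convergence_SUP SUP_mult_left_ennreal)
  finally show ?case by (simp add: SUP)
qed

lemma integral_mixture:
  fixes f :: "'a::topological_space \<Rightarrow> real"
  assumes I: "finite I" and a: "\<And>i. i \<in> I \<Longrightarrow> 0 \<le> a i"
    and M: "\<And>i. i \<in> I \<Longrightarrow> sets (M i) = sets borel"
    and f: "\<And>i. i \<in> I \<Longrightarrow> integrable (M i) f" "f \<in> borel_measurable borel"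
  shows "integrable (mixture I a M) f"
    and "integral\<^sup>L (mixture I a M) f = (\<Sum>i\<in>I. a i * integral\<^sup>L (M i) f)"
proof -
  have 1: "nn_integral (mixture I a M) g = ennreal (\<Sum>i\<in>I. a i * enn2real (nn_integral (M i) g))"
    if "g \<in> borel_measurable borel" "\<And>i. i \<in> I \<Longrightarrow> nn_integral (M i) g < \<infinity>" for g
  proof -
    have "nn_integral (mixture I a M) g = (\<Sum>i\<in>I. ennreal (a i * enn2real (nn_integral (M i) g)))"
      using that a M by (auto simp: nn_integral_mixture ennreal_mult intro!: sum.cong)
    also have "\<dots> = ennreal (\<Sum>i\<in>I. a i * enn2real (nn_integral (M i) g))"
      using a by (intro sum_ennreal) auto
    finally show ?thesis .
  qed
  have fin: "nn_integral (M i) (\<lambda>x. ennreal (norm (f x))) < \<infinity>"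
      "nn_integral (M i) (\<lambda>x. ennreal (f x)) < \<infinity>"
      "nn_integral (M i) (\<lambda>x. ennreal (- f x)) < \<infinity>" if "i \<in> I" for i
    using f(1)[OF that, unfolded integrable_iff_bounded] f(1)[OF that, unfolded real_integrable_def]
    by (auto simp: less_top simp del: real_norm_def)
  have meas: "f \<in> borel_measurable (mixture I a M)"
    using f(2) measurable_cong_sets[OF sets_mixture refl] by blast
  show int: "integrable (mixture I a M) f"
    unfolding integrable_iff_bounded using meas fin f(2) by (subst 1) auto
  show "integral\<^sup>L (mixture I a M) f = (\<Sum>i\<in>I. a i * integral\<^sup>L (M i) f)"
  proof -
    have "integral\<^sup>L (mixture I a M) f
        = (\<Sum>i\<in>I. a i * enn2real (nn_integral (M i) (\<lambda>x. ennreal (f x))))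
        - (\<Sum>i\<in>I. a i * enn2real (nn_integral (M i) (\<lambda>x. ennreal (- f x))))"
      unfolding real_lebesgue_integral_def[OF int] using f(2) fin a
      by (subst 1, simp, simp, subst 1, simp, simp) (simp add: sum_nonneg)
    also have "\<dots> = (\<Sum>i\<in>I. a i * integral\<^sup>L (M i) f)"
      by (simp add: sum_subtractf[symmetric] real_lebesgue_integral_def[OF f(1)] right_diff_distrib)
    finally show ?thesis .
  qed
qed

lemma funpow_shift: "(shift ^^ n) y i = y (i + n)"
  by (induction n arbitrary: i) (auto simp: shift_def)

lemma finite_Fix: "finite (Fix n)"
proof (cases "n = 0")
  case True
  then have "Fix n \<subseteq> {orbit_measure 0 (\<lambda>_. False)}"
    by (auto simp: Fix_def orbit_measure_def mixture_def)
  then show ?thesis by (rule finite_subset) simp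
next
  case False
  let ?e = "\<lambda>S i. i mod n \<in> S"
  have "Fix n \<subseteq> (\<lambda>S. orbit_measure n (?e S)) ` Pow {..<n}"
  proof
    fix \<mu> assume "\<mu> \<in> Fix n"
    then obtain y where y: "(shift ^^ n) y = y" "\<mu> = orbit_measure n y" by (auto simp: Fix_def)
    have per: "y (i + n) = y i" for i using y(1) by (metis funpow_shift)
    have perk: "y (i + k * n) = y i" for i k
      by (induction k) (auto simp: per add.assoc[symmetric] add.commute[of n] add.left_commute[of n])
    have "y i = y (i mod n)" for i
      using perk[of "i mod n" "i div n"] by simp
    then have "y = ?e {i. i < n \<and> y i}" using False by (auto simp: fun_eq_iff)
    then show "\<mu> \<in> (\<lambda>S. orbit_measure n (?e S)) ` Pow {..<n}"
      using y(2) by (intro image_eqI[where x = "{i. i < n \<and> y i}"]) auto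
  qed
  then show ?thesis by (rule finite_subset) simp
qed

lemma Fix_nonempty: "Fix n \<noteq> {}"
  unfolding Fix_def by (auto simp: fun_eq_iff funpow_shift intro!: exI[of _ "\<lambda>_. True"])

lemma compact_UNIV_bseq: "compact (UNIV :: bseq set)"
proof -
  have "compact_space (product_topology (\<lambda>_::nat. euclidean :: bool topology) UNIV)"
    
    using finite_imp_compact[of "UNIV :: bool set"]
    by (simp add: compact_space_product_topology) (simp add: compact_space_def)
  then show ?thesis
    by (simp add: euclidean_product_topology compact_space_def)
qed

lemma integrable_continuous:
  fixes w :: "bseq \<times> bseq \<Rightarrow> real"
  assumes "continuous_on UNIV w" and "\<pi> \<in> borel_probs"
  shows "integrable \<pi> w"
proof -
  interpret prob_space \<pi> using assms(2) by (simp add: borel_probs_def)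
  have "compact (w ` UNIV)"
    using compact_Times[OF compact_UNIV_bseq compact_UNIV_bseq] assms(1)
    by (intro compact_continuous_image) auto
  then obtain B where "\<And>x. norm (w x) \<le> B"
    using compact_imp_bounded bounded_iff by (metis rangeI)
  moreover have "w \<in> borel_measurable \<pi>"
    using borel_measurable_continuous_onI[OF assms(1)] assms(2) measurable_cong_sets[of \<pi> borel]
    by (auto simp: borel_probs_def)
  ultimately show ?thesis
    by (intro integrable_const_bound[of _ B]) auto
qed

lemma integral_zeta:
  fixes w :: "bseq \<times> bseq \<Rightarrow> real"
  assumes "continuous_on UNIV w"
    and "\<And>\<mu> \<nu>. \<mu> \<in> Fix n \<Longrightarrow> \<nu> \<in> Fix n \<Longrightarrow> P \<mu> \<nu> \<in> borel_probs"
  shows "integral\<^sup>L (zeta c P \<beta> n) w =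
      (\<Sum>\<mu>\<in>Fix n. \<Sum>\<nu>\<in>Fix n. exp (\<beta> * real n * integral\<^sup>L (P \<mu> \<nu>) c) * integral\<^sup>L (P \<mu> \<nu>) w)
    / (\<Sum>\<mu>\<in>Fix n. \<Sum>\<nu>\<in>Fix n. exp (\<beta> * real n * integral\<^sup>L (P \<mu> \<nu>) c))"
  unfolding zeta_def
proof (subst integral_mixture(2))
  show "finite (Fix n \<times> Fix n)" by (simp add: finite_Fix)
  show "w \<in> borel_measurable borel" by (rule borel_measurable_continuous_onI[OF assms(1)])
qed (use assms integrable_continuous[OF assms(1)] in
    \<open>auto simp: weight_def borel_probs_def split_beta sum.cartesian_product sum_divide_distrib
       intro!: divide_nonneg_nonneg sum_nonneg\<close>)

lemma prob_space_zeta: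
  assumes "\<And>\<mu> \<nu>. \<mu> \<in> Fix n \<Longrightarrow> \<nu> \<in> Fix n \<Longrightarrow> P \<mu> \<nu> \<in> borel_probs"
  shows "zeta c P \<beta> n \<in> borel_probs"
proof -
  let ?I = "Fix n \<times> Fix n" and ?W = "\<lambda>(\<mu>, \<nu>). weight c \<beta> n (P \<mu> \<nu>)"
  have pos: "sum ?W ?I > 0"
    using finite_Fix Fix_nonempty by (intro sum_pos) (auto simp: weight_def)
  have "emeasure (zeta c P \<beta> n) UNIV
      = (\<Sum>i\<in>?I. ennreal (?W i / sum ?W ?I) * emeasure (case i of (\<mu>, \<nu>) \<Rightarrow> P \<mu> \<nu>) UNIV)"
    unfolding zeta_def using assms
    by (subst emeasure_mixture) (auto simp: borel_probs_def split_beta)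
  also have "\<dots> = (\<Sum>i\<in>?I. ennreal (?W i / sum ?W ?I))"
  proof (intro sum.cong refl)
    fix i assume "i \<in> ?I"
    then have "(case i of (\<mu>, \<nu>) \<Rightarrow> P \<mu> \<nu>) \<in> borel_probs" using assms by auto
    then have "emeasure (case i of (\<mu>, \<nu>) \<Rightarrow> P \<mu> \<nu>) UNIV = 1"
      using prob_space.emeasure_space_1 sets_eq_imp_space_eq[of _ "borel :: (bseq \<times> bseq) measure"]
      by (fastforce simp: borel_probs_def)
    then show "ennreal (?W i / sum ?W ?I) * emeasure (case i of (\<mu>, \<nu>) \<Rightarrow> P \<mu> \<nu>) UNIV
        = ennreal (?W i / sum ?W ?I)" by simp
  qed
  also have "\<dots> = ennreal (\<Sum>i\<in>?I. ?W i / sum ?W ?I)"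
    using pos by (intro sum_ennreal) (auto simp: weight_def intro!: divide_nonneg_pos)
  also have "\<dots> = 1"
    using pos by (simp add: sum_divide_distrib[symmetric])
  finally show ?thesis
    by (auto simp: borel_probs_def zeta_def intro!: prob_spaceI)
qed

end

theory Submission
  imports Defs
begin

text \<open>
  Averages of \<open>\<sigma>\<close>-invariant measures are \<open>\<sigma>\<close>-invariant, and invariance of the marginals passes to the
  weak* limit. For maximality, let \<open>\<pi>\<close> have invariant marginals. Each marginal is approximated, for all
  large \<open>n\<close>, by a measure in \<open>Fix n\<close> with almost the same frequencies of \<open>L\<close>-words; redistributing
  \<open>\<pi>\<close> over the two orbits couples these periodic measures at almost the same value of the integral of \<open>c\<close>, as
  \<open>c\<close> is uniformly close to a function of the first \<open>L\<close> coordinates. Hence the best plan between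
  measures in \<open>Fix n\<close> asymptotically reaches \<open>\<integral>c d\<pi>\<close>. Finally \<open>\<zeta>\<close> is a Gibbs average at
  inverse temperature \<open>\<beta> n\<close> over at most \<open>4 ^ n\<close> plans, so its entropy costs at most
  \<open>ln (4 ^ n) / (\<beta> n) = ln 4 / \<beta>\<close>, which vanishes as \<open>\<beta> \<rightarrow> \<infinity>\<close>.
\<close>

subsection \<open>Cylinders\<close>

text \<open>A word of length \<open>L\<close> is encoded as a point of the same space, padded with
  \<open>False\<close>. Words can then be fed directly to \<open>c\<close> and to Birkhoff sums, and
  cylinders are the fibres of \<open>trunc L\<close>.\<close>

definition trunc :: "nat \<Rightarrow> bseq \<Rightarrow> bseq" where
  "trunc L x = (\<lambda>i. i < L \<and> x i)"

lemma trunc_eq_iff: "trunc L x = trunc L y \<longleftrightarrow> (\<forall>i<L. x i = y i)"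
  by (auto simp: trunc_def fun_eq_iff)

lemma trunc_trunc: "L \<le> M \<Longrightarrow> trunc L (trunc M x) = trunc L x"
  by (auto simp: trunc_def fun_eq_iff)

lemma finite_range_trunc: "finite (range (trunc L))"
proof (rule finite_subset)
  show "range (trunc L) \<subseteq> (\<lambda>S i. i \<in> S) ` Pow {..<L}"
  proof
    fix w assume "w \<in> range (trunc L)"
    then obtain x where "w = trunc L x" by auto
    then have "w = (\<lambda>i. i \<in> {i. i < L \<and> x i})" "{i. i < L \<and> x i} \<in> Pow {..<L}"
      by (auto simp: trunc_def)
    then show "w \<in> (\<lambda>S i. i \<in> S) ` Pow {..<L}" by (rule image_eqI)
  qed
qed simp

lemma open_cylinder: "open {x. trunc L x = u}"
proof -
  have "open ((\<lambda>x::bseq. x i) -` {b})" for i and b :: bool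
    by (intro open_vimage) (auto simp: Topological_Spaces.open_discrete)
  then have "open (\<Inter>i<L. (\<lambda>x::bseq. x i) -` {v i})" for v :: bseq
    by (intro open_INT) auto
  moreover have "{x. trunc L x = trunc L v} = (\<Inter>i<L. (\<lambda>x::bseq. x i) -` {v i})" for v
    by (auto simp: trunc_eq_iff)
  ultimately have *: "open {x. trunc L x = trunc L v}" for v by simp
  show ?thesis
  proof (cases "u \<in> range (trunc L)")
    case True
    then show ?thesis using * by auto
  next
    case False
    then have "{x. trunc L x = u} = {}" by auto
    then show ?thesis by simp
  qed
qed

text \<open>Any preimage under such an \<open>f\<close> is a union of cylinders, hence open.
  Continuity of cylinder indicators and of truncated functions, and through it their measurability,
  comes from here.\<close>

lemma continuous_on_local:
  fixes f :: "bseq \<Rightarrow> 'a::topological_space"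
  assumes "\<And>x. f (trunc L x) = f x"
  shows "continuous_on UNIV f"
proof (subst continuous_on_open_vimage, simp, intro allI impI)
  fix B :: "'a set"
  have "f -` B = (\<Union>u\<in>{u. f u \<in> B}. {x. trunc L x = u})"
    using assms by auto
  moreover have "open \<dots>"
    by (intro open_UN) (auto simp: open_cylinder)
  ultimately show "open (f -` B \<inter> UNIV)" by simp
qed

lemma open_contains_cylinder:
  fixes U :: "bseq set"
  assumes "open U" "x \<in> U"
  obtains L where "\<And>y. trunc L y = trunc L x \<Longrightarrow> y \<in> U"
proof -
  have "openin (product_topology (\<lambda>_::nat. euclidean :: bool topology) UNIV) U"
    using assms(1) by (simp add: euclidean_product_topology)
  from product_topology_open_contains_basis[OF this assms(2)]
  obtain X where X: "x \<in> (\<Pi>\<^sub>E i\<in>UNIV. X i)" "finite {i. X i \<noteq> UNIV}" "(\<Pi>\<^sub>E i\<in>UNIV. X i) \<subseteq> U"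
    by auto
  obtain L where L: "{i. X i \<noteq> UNIV} \<subseteq> {..<L}"
    using X(2) finite_nat_bounded by blast
  have "y \<in> U" if "trunc L y = trunc L x" for y
  proof -
    have "y i \<in> X i" for i
      using that L X(1) by (cases "i < L") (auto simp: trunc_eq_iff PiE_def Pi_def)
    then show ?thesis using X(3) by auto
  qed
  then show ?thesis by (rule that)
qed

text \<open>A Lebesgue number argument phrased with cylinders: every point has a box of cylinders on
  which \<open>c\<close> moves by less than \<open>e / 2\<close>, finitely many boxes cover the
  compact product, and \<open>L\<close> is the longest word length among them.\<close>

lemma uniform_trunc:
  fixes c :: "bseq \<times> bseq \<Rightarrow> real"
  assumes c: "continuous_on UNIV c" and e: "e > 0"
  obtains L where "\<And>x y. \<bar>c (x, y) - c (trunc L x, trunc L y)\<bar> \<le> e"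
proof -
  let ?T = "\<lambda>L z. (trunc L (fst z), trunc L (snd z))"
  have "\<exists>L. \<forall>z'. ?T L z' = ?T L z \<longrightarrow> \<bar>c z' - c z\<bar> < e / 2" for z
  proof -
    have "open (c -` ball (c z) (e / 2))"
      using c by (intro open_vimage) auto
    moreover have "z \<in> c -` ball (c z) (e / 2)" using e by simp
    ultimately obtain A B where AB: "open A" "open B" "fst z \<in> A" "snd z \<in> B" "A \<times> B \<subseteq> c -` ball (c z) (e / 2)"
      by (metis open_prod_elim mem_Times_iff)
    obtain L1 where L1: "\<And>y. trunc L1 y = trunc L1 (fst z) \<Longrightarrow> y \<in> A"
      using open_contains_cylinder[OF AB(1,3)] by blast
    obtain L2 where L2: "\<And>y. trunc L2 y = trunc L2 (snd z) \<Longrightarrow> y \<in> B"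
      using open_contains_cylinder[OF AB(2,4)] by blast
    have "\<bar>c z' - c z\<bar> < e / 2" if "?T (max L1 L2) z' = ?T (max L1 L2) z" for z'
    proof -
      have "fst z' \<in> A" "snd z' \<in> B"
        using that by (auto intro!: L1 L2 simp: trunc_eq_iff)
      then have "c z' \<in> ball (c z) (e / 2)" using AB(5) by (cases z') auto
      then show ?thesis by (simp add: dist_real_def abs_minus_commute)
    qed
    then show ?thesis by blast
  qed
  then obtain l where l: "\<And>z z'. ?T (l z) z' = ?T (l z) z \<Longrightarrow> \<bar>c z' - c z\<bar> < e / 2"
    by metis
  have op: "open ({x. trunc (l z) x = trunc (l z) (fst z)} \<times> {x. trunc (l z) x = trunc (l z) (snd z)})" for z
    by (intro open_Times open_cylinder)
  have cover: "(UNIV :: (bseq \<times> bseq) set)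
      \<subseteq> (\<Union>z. {x. trunc (l z) x = trunc (l z) (fst z)} \<times> {x. trunc (l z) x = trunc (l z) (snd z)})"
  proof
    fix z :: "bseq \<times> bseq"
    have "z \<in> {x. trunc (l z) x = trunc (l z) (fst z)} \<times> {x. trunc (l z) x = trunc (l z) (snd z)}"
      by (simp add: mem_Times_iff)
    then show "z \<in> (\<Union>z. {x. trunc (l z) x = trunc (l z) (fst z)} \<times> {x. trunc (l z) x = trunc (l z) (snd z)})"
      by blast
  qed
  have "compact (UNIV :: (bseq \<times> bseq) set)"
    using compact_Times[OF compact_UNIV_bseq compact_UNIV_bseq] by simp
  then obtain D where D: "finite D"
    "UNIV \<subseteq> (\<Union>z\<in>D. {x. trunc (l z) x = trunc (l z) (fst z)} \<times> {x. trunc (l z) x = trunc (l z) (snd z)})"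
    using op cover by (rule compactE_image[where C = UNIV]) blast
  define L where "L = Max (insert 0 (l ` D))"
  have "\<bar>c (x, y) - c (trunc L x, trunc L y)\<bar> \<le> e" for x y
  proof -
    obtain z where z: "z \<in> D" "trunc (l z) x = trunc (l z) (fst z)" "trunc (l z) y = trunc (l z) (snd z)"
      using subsetD[OF D(2) UNIV_I, of "(x, y)"] by auto
    \<comment> \<open>Truncating at \<open>L\<close> does not alter the first \<open>l z\<close>
      letters, so \<open>(x, y)\<close> and its truncation lie in the same box around
      \<open>z\<close>; the triangle inequality through \<open>c z\<close> gives
      \<open>e\<close>.\<close>
    have "l z \<le> L" using z(1) D(1) by (auto simp: L_def)
    then have "\<bar>c (x, y) - c z\<bar> < e / 2" "\<bar>c (trunc L x, trunc L y) - c z\<bar> < e / 2"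
      using z by (intro l; simp add: trunc_trunc)+
    then show ?thesis by linarith
  qed
  then show ?thesis by (rule that)
qed

section \<open>Borel probability measures and their values on cylinders\<close>

lemma borel_probs_simps:
  assumes "M \<in> borel_probs"
  shows "prob_space M" "sets M = sets borel" "space M = UNIV"
  using assms sets_eq_imp_space_eq[of M borel] by (auto simp: borel_probs_def)

lemma borel_probs_measurable:
  assumes "M \<in> borel_probs"
  shows "measurable M N = measurable borel N"
  using borel_probs_simps(2)[OF assms] by (intro measurable_cong_sets) auto

text \<open>Two cylinders are nested or disjoint, so together with the empty set they form a
  pi-system. Each length has only finitely many words, so an open set is a countable union of
  cylinders and the pi-system generates the Borel sets.\<close>

lemma cylinder_measure_eqI:
  assumes M: "M \<in> borel_probs" and N: "N \<in> borel_probs"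
    and eq: "\<And>L u. measure M {x. trunc L x = u} = measure N {x. trunc L x = u}"
  shows "M = N"
proof (rule measure_eqI_generator_eq)
  interpret M: prob_space M by (rule borel_probs_simps[OF M])
  interpret N: prob_space N by (rule borel_probs_simps[OF N])
  let ?E = "insert {} {{x. trunc L x = u} | L u. True}"
  show "Int_stable ?E"
  proof (rule Int_stableI)
    have *: "{x. trunc L x = u} \<inter> {x. trunc K x = v} \<in> ?E" if "L \<le> K" for L K u v
    proof (cases "trunc L v = u")
      case True
      then have "{x. trunc L x = u} \<inter> {x. trunc K x = v} = {x. trunc K x = v}"
        using that by (auto simp: trunc_trunc)
      then show ?thesis by blast
    next
      case False
      then have "{x. trunc L x = u} \<inter> {x. trunc K x = v} = {}"
        using that by (auto simp: trunc_trunc)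
      then show ?thesis by simp
    qed
    fix A B assume "A \<in> ?E" "B \<in> ?E"
    then consider "A = {}" | "B = {}" | L K u v where "A = {x. trunc L x = u}" "B = {x. trunc K x = v}"
      by auto
    then show "A \<inter> B \<in> ?E"
    proof cases
      case 3
      then show ?thesis using *[of L K u v] *[of K L v u] by (cases "L \<le> K") (auto simp: Int_commute)
    qed auto
  qed
  have "sets (borel :: bseq measure) = sigma_sets UNIV ?E"
  proof
    show "sigma_sets UNIV ?E \<subseteq> sets borel"
      using open_cylinder by (intro sets.sigma_sets_subset[of _ borel, simplified]) (auto intro: borel_open)
    have "U \<in> sigma_sets UNIV ?E" if "open U" for U :: "bseq set"
    proof -
      let ?I = "{(L, u). u \<in> range (trunc L) \<and> {x. trunc L x = u} \<subseteq> U}"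
      have "?I \<subseteq> (SIGMA L:UNIV. range (trunc L))" by auto
      then have "countable ?I"
        by (rule countable_subset) (auto intro: countable_finite[OF finite_range_trunc])
      then have "(\<Union>(L, u)\<in>?I. {x. trunc L x = u}) \<in> sigma_sets UNIV ?E"
        by (intro sigma_sets_UNION countable_image) (auto intro!: sigma_sets.Basic)
      moreover have "(\<Union>(L, u)\<in>?I. {x. trunc L x = u}) = U"
      proof (intro equalityI subsetI)
        fix x assume "x \<in> U"
        then obtain L where "\<And>y. trunc L y = trunc L x \<Longrightarrow> y \<in> U"
          using open_contains_cylinder[OF \<open>open U\<close>] by blast
        then have "(L, trunc L x) \<in> ?I" by auto
        then show "x \<in> (\<Union>(L, u)\<in>?I. {x. trunc L x = u})" by blast
      qed auto
      ultimately show ?thesis by simp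
    qed
    then have "sigma_sets UNIV {U. open U} \<subseteq> sigma_sets UNIV ?E"
      by (intro sigma_sets_mono) blast
    then show "sets borel \<subseteq> sigma_sets UNIV ?E"
      by (simp add: borel_def)
  qed
  then show "sets M = sigma_sets UNIV ?E" "sets N = sigma_sets UNIV ?E"
    using borel_probs_simps[OF M] borel_probs_simps[OF N] by auto
  \<comment> \<open>The word of length 0 turns the whole space into a cylinder, which supplies the
    exhausting sequence.\<close>
  show "range (\<lambda>_::nat. UNIV) \<subseteq> ?E"
    by (auto intro!: exI[of _ 0] exI[of _ "trunc 0 undefined"] simp: trunc_eq_iff)
  show "emeasure M A = emeasure N A" if "A \<in> ?E" for A
    using that eq by (auto simp: M.emeasure_eq_measure N.emeasure_eq_measure)
qed (auto simp: prob_space.emeasure_space_1[OF borel_probs_simps(1)[OF M], simplified borel_probs_simps[OF M]])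

lemma integral_finite_range:
  fixes g :: "'b \<Rightarrow> real"
  assumes "prob_space M" "finite W" "\<And>x. h x \<in> W"
    and "\<And>w. w \<in> W \<Longrightarrow> {x \<in> space M. h x = w} \<in> sets M"
  shows "(\<integral>x. g (h x) \<partial>M) = (\<Sum>w\<in>W. measure M {x \<in> space M. h x = w} * g w)"
proof -
  interpret prob_space M by fact
  have "(\<integral>x. g (h x) \<partial>M) = (\<integral>x. (\<Sum>w\<in>W. g w * indicator {x \<in> space M. h x = w} x) \<partial>M)"
  proof (rule Bochner_Integration.integral_cong[OF refl])
    fix x assume "x \<in> space M"
    then have "(\<Sum>w\<in>W. g w * indicator {x \<in> space M. h x = w} x) = (\<Sum>w\<in>W. if h x = w then g w else 0)"
      by (intro sum.cong) (auto simp: indicator_def)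
    then show "g (h x) = (\<Sum>w\<in>W. g w * indicator {x \<in> space M. h x = w} x)"
      using assms(2,3) by (simp add: sum.delta')
  qed
  also have "\<dots> = (\<Sum>w\<in>W. measure M {x \<in> space M. h x = w} * g w)"
    using assms(4) sets.sets_into_space[of _ M]
    by (subst Bochner_Integration.integral_sum)
      (auto intro!: sum.cong integrable_real_indicator integrable_mult_right simp: Int_absorb2 mult.commute less_top[symmetric])
  finally show ?thesis .
qed

subsection \<open>Finite couplings and Gibbs averages\<close>

text \<open>
  Applying \<open>1 + s \<le> exp s\<close> to \<open>s = t a\<^sub>k - ln N - t a\<^sub>i\<close> bypasses the entropy in the Gibbs variational
  principle.
\<close>

lemma gibbs_lower_bound:
  fixes a :: "'i \<Rightarrow> real"
  assumes I: "finite I" "k \<in> I" "real (card I) \<le> N"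
  shows "(t * a k - ln N) * (\<Sum>i\<in>I. exp (t * a i)) \<le> t * (\<Sum>i\<in>I. exp (t * a i) * a i)"
proof -
  have N: "N \<ge> 1" using I card_gt_0_iff[of I] by fastforce
  have "exp (t * a i) * (t * a k - ln N - t * a i) \<le> exp (t * a k) / N - exp (t * a i)" for i
  proof -
    have "exp (t * a i) * (1 + (t * a k - ln N - t * a i)) \<le> exp (t * a i) * exp (t * a k - ln N - t * a i)"
      by (intro mult_left_mono exp_ge_add_one_self) auto
    also have "\<dots> = exp (t * a k) / N"
      using N by (simp add: exp_diff)
    finally show ?thesis by (simp add: algebra_simps)
  qed
  then have "(\<Sum>i\<in>I. exp (t * a i) * (t * a k - ln N - t * a i)) \<le> (\<Sum>i\<in>I. exp (t * a k) / N - exp (t * a i))"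
    by (intro sum_mono)
  also have "\<dots> = card I * (exp (t * a k) / N) - (\<Sum>i\<in>I. exp (t * a i))"
    by (simp add: sum_subtractf)
  also have "\<dots> \<le> exp (t * a k) - (\<Sum>i\<in>I. exp (t * a i))"
    using I N by (simp add: field_simps)
  \<comment> \<open>The summand \<open>i = k\<close> alone absorbs
    \<open>exp (t * a k)\<close>.\<close>
  also have "\<dots> \<le> 0"
    using I member_le_sum[of k I "\<lambda>i. exp (t * a i)"] by auto
  finally show ?thesis
    by (simp add: algebra_simps sum_subtractf sum_distrib_left sum_distrib_right sum.distrib)
qed

text \<open>The row deficits \<open>r\<close> and the column deficits \<open>s\<close> are
  nonnegative with equal total mass, so adding their normalised product fills all rows and columns
  at once.\<close>

lemma coupling_extend:
  fixes R\<^sub>0 :: "'i \<Rightarrow> 'j \<Rightarrow> real"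
  assumes fin: "finite I" "finite J"
    and row: "\<And>i. i \<in> I \<Longrightarrow> (\<Sum>j\<in>J. R\<^sub>0 i j) \<le> a i"
    and col: "\<And>j. j \<in> J \<Longrightarrow> (\<Sum>i\<in>I. R\<^sub>0 i j) \<le> b j"
    and eq: "sum a I = sum b J"
  obtains R where "\<And>i j. i \<in> I \<Longrightarrow> j \<in> J \<Longrightarrow> R\<^sub>0 i j \<le> R i j"
    "\<And>i. i \<in> I \<Longrightarrow> (\<Sum>j\<in>J. R i j) = a i" "\<And>j. j \<in> J \<Longrightarrow> (\<Sum>i\<in>I. R i j) = b j"
proof
  define r where "r i = a i - (\<Sum>j\<in>J. R\<^sub>0 i j)" for i
  define s where "s j = b j - (\<Sum>i\<in>I. R\<^sub>0 i j)" for j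
  define R where "R i j = R\<^sub>0 i j + r i * s j / sum r I" for i j
  have r: "r i \<ge> 0" if "i \<in> I" for i using row[OF that] by (simp add: r_def)
  have s: "s j \<ge> 0" if "j \<in> J" for j using col[OF that] by (simp add: s_def)
  have rs: "sum r I = sum s J"
    using eq sum.swap[of R\<^sub>0 J I] by (simp add: r_def s_def sum_subtractf)
  show "R\<^sub>0 i j \<le> R i j" if "i \<in> I" "j \<in> J" for i j
    using r s that by (auto simp: R_def intro!: divide_nonneg_nonneg sum_nonneg mult_nonneg_nonneg)
  show "(\<Sum>j\<in>J. R i j) = a i" if "i \<in> I" for i
  proof -
    have "(\<Sum>j\<in>J. r i * s j / sum r I) = r i * (sum s J / sum r I)"
      by (simp add: sum_distrib_left sum_divide_distrib)
    also have "\<dots> = r i"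
      \<comment> \<open>If the total deficit is 0, every single deficit vanishes by nonnegativity,
        and the convention \<open>x / 0 = 0\<close> makes the correction 0 as well.\<close>
      using that r fin rs sum_nonneg_eq_0_iff[of I r] by (cases "sum r I = 0") auto
    finally show ?thesis by (simp add: R_def sum.distrib r_def)
  qed
  show "(\<Sum>i\<in>I. R i j) = b j" if "j \<in> J" for j
  proof -
    have "(\<Sum>i\<in>I. r i * s j / sum r I) = sum r I * s j / sum r I"
      by (simp only: sum_distrib_right sum_divide_distrib)
    also have "\<dots> = s j"
      using that s fin rs sum_nonneg_eq_0_iff[of J s] by (cases "sum r I = 0") auto
    finally show ?thesis by (simp add: R_def sum.distrib s_def)
  qed
qed

lemma sum_by_value:
  fixes F :: "'b \<Rightarrow> real"
  assumes "finite I" "finite W" "\<And>i. i \<in> I \<Longrightarrow> X i \<in> W"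
  shows "(\<Sum>i\<in>I. F (X i)) = (\<Sum>w\<in>W. card {i\<in>I. X i = w} * F w)"
proof -
  have "(\<Sum>i\<in>I. F (X i)) = (\<Sum>w\<in>W. \<Sum>i | i \<in> I \<and> X i = w. F (X i))"
    using assms by (intro sum.group[symmetric]) auto
  also have "\<dots> = (\<Sum>w\<in>W. card {i\<in>I. X i = w} * F w)"
    by (intro sum.cong) auto
  finally show ?thesis .
qed

text \<open>
  With \<open>m1 = max p1 q1\<close> and \<open>m2 = max p2 q2\<close>, where \<open>p1, p2\<close> are the marginals of \<open>p\<close> and \<open>q1, q2\<close> the
  empirical frequencies, the kernel \<open>p u v / (m1 u \<cdot> m2 v \<cdot> n\<^sup>2)\<close> is a subcoupling. Completing it to a
  coupling can only increase the integral because \<open>C \<ge> 0\<close>.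
\<close>

lemma transfer_coupling:
  fixes p :: "'u \<Rightarrow> 'v \<Rightarrow> real" and X :: "'i \<Rightarrow> 'u" and Z :: "'j \<Rightarrow> 'v" and \<delta> B :: real
  assumes fin: "finite U" "finite V" "finite I" "finite J"
    and n: "card I = n" "card J = n" "n > 0"
    and XZ: "\<And>i. i \<in> I \<Longrightarrow> X i \<in> U" "\<And>j. j \<in> J \<Longrightarrow> Z j \<in> V"
    and p: "\<And>u v. u \<in> U \<Longrightarrow> v \<in> V \<Longrightarrow> p u v \<ge> 0"
    and C: "\<And>u v. 0 \<le> C u v" "\<And>u v. C u v \<le> B"
    and X\<delta>: "\<And>u. u \<in> U \<Longrightarrow> \<bar>card {i\<in>I. X i = u} / n - (\<Sum>v\<in>V. p u v)\<bar> \<le> \<delta>"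
    and Z\<delta>: "\<And>v. v \<in> V \<Longrightarrow> \<bar>card {j\<in>J. Z j = v} / n - (\<Sum>u\<in>U. p u v)\<bar> \<le> \<delta>"
  obtains R where "\<And>i j. i \<in> I \<Longrightarrow> j \<in> J \<Longrightarrow> 0 \<le> R i j"
    "\<And>i. i \<in> I \<Longrightarrow> (\<Sum>j\<in>J. R i j) = 1 / n" "\<And>j. j \<in> J \<Longrightarrow> (\<Sum>i\<in>I. R i j) = 1 / n"
    "(\<Sum>u\<in>U. \<Sum>v\<in>V. p u v * C u v) - 2 * \<delta> * B * card U * card V \<le> (\<Sum>i\<in>I. \<Sum>j\<in>J. R i j * C (X i) (Z j))"
proof -
  define p1 where "p1 u = (\<Sum>v\<in>V. p u v)" for u
  define p2 where "p2 v = (\<Sum>u\<in>U. p u v)" for v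
  define q1 where "q1 u = card {i\<in>I. X i = u} / n" for u
  define q2 where "q2 v = card {j\<in>J. Z j = v} / n" for v
  define m1 where "m1 u = max (p1 u) (q1 u)" for u
  define m2 where "m2 v = max (p2 v) (q2 v)" for v
  have q0: "q1 u \<ge> 0" "q2 v \<ge> 0" for u v by (auto simp: q1_def q2_def)
  have m0: "m1 u \<ge> 0" "m2 v \<ge> 0" "p1 u \<le> m1 u" "q1 u \<le> m1 u" "p2 v \<le> m2 v" "q2 v \<le> m2 v" for u v
    using q0 by (auto simp: m1_def m2_def le_max_iff_disj)
  have m\<delta>: "m1 u - q1 u \<le> \<delta>" "m2 v - q2 v \<le> \<delta>" if "u \<in> U" "v \<in> V" for u v
    using X\<delta>[OF that(1)] Z\<delta>[OF that(2)]
    by (auto simp: m1_def m2_def p1_def p2_def q1_def q2_def max_def)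
  have pm: "p u v \<le> p1 u" "p u v \<le> p2 v" if "u \<in> U" "v \<in> V" for u v
    using p that fin by (auto simp: p1_def p2_def intro!: member_le_sum)
  have ratio: "q / m \<le> 1" "0 \<le> q / m" if "0 \<le> q" "q \<le> m" for q m :: real
    using that by (auto simp: divide_simps)
  have ratios: "q1 u / m1 u \<le> 1" "0 \<le> q1 u / m1 u" "q2 v / m2 v \<le> 1" "0 \<le> q2 v / m2 v" for u v
    using ratio q0 m0 by auto
  define K where "K u v = p u v / (m1 u * m2 v * n\<^sup>2)" for u v
  have cnt1: "(\<Sum>i\<in>I. F (X i)) = (\<Sum>u\<in>U. n * q1 u * F u)" for F :: "'u \<Rightarrow> real"
    using fin XZ n by (subst sum_by_value[of I U]) (auto simp: q1_def)
  have cnt2: "(\<Sum>j\<in>J. F (Z j)) = (\<Sum>v\<in>V. n * q2 v * F v)" for F :: "'v \<Rightarrow> real"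
    using fin XZ n by (subst sum_by_value[of J V]) (auto simp: q2_def)
  have row: "(\<Sum>j\<in>J. K (X i) (Z j)) \<le> 1 / n" if i: "i \<in> I" for i
  proof -
    let ?u = "X i"
    \<comment> \<open>Grouping the indices \<open>j\<close> by the value of \<open>Z j\<close>
      produces the factor \<open>n * q2 v\<close>. The ratios \<open>q2 v / m2 v\<close> are at most
      1, and what is left sums to \<open>p1 / m1 / n\<close> at \<open>?u\<close>.\<close>
    have "(\<Sum>j\<in>J. K ?u (Z j)) = (\<Sum>v\<in>V. p ?u v / m1 ?u / n * (q2 v / m2 v))"
      using n by (subst cnt2) (auto intro!: sum.cong simp: K_def field_simps power2_eq_square)
    also have "\<dots> \<le> (\<Sum>v\<in>V. p ?u v / m1 ?u / n * 1)"
      using p XZ i m0 ratios by (intro sum_mono mult_left_mono) auto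
    also have "\<dots> = p1 ?u / m1 ?u / n" by (simp add: p1_def sum_divide_distrib)
    also have "\<dots> \<le> 1 / n"
      using m0 p XZ i by (intro divide_right_mono ratio) (auto simp: p1_def intro!: sum_nonneg)
    finally show ?thesis .
  qed
  have col: "(\<Sum>i\<in>I. K (X i) (Z j)) \<le> 1 / n" if j: "j \<in> J" for j
  proof -
    let ?v = "Z j"
    have "(\<Sum>i\<in>I. K (X i) ?v) = (\<Sum>u\<in>U. p u ?v / m2 ?v / n * (q1 u / m1 u))"
      using n by (subst cnt1) (auto intro!: sum.cong simp: K_def field_simps power2_eq_square)
    also have "\<dots> \<le> (\<Sum>u\<in>U. p u ?v / m2 ?v / n * 1)"
      using p XZ j m0 ratios by (intro sum_mono mult_left_mono) auto
    also have "\<dots> = p2 ?v / m2 ?v / n" by (simp add: p2_def sum_divide_distrib)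
    also have "\<dots> \<le> 1 / n"
      using m0 p XZ j by (intro divide_right_mono ratio) (auto simp: p2_def intro!: sum_nonneg)
    finally show ?thesis .
  qed
  obtain R where R: "\<And>i j. i \<in> I \<Longrightarrow> j \<in> J \<Longrightarrow> K (X i) (Z j) \<le> R i j"
    "\<And>i. i \<in> I \<Longrightarrow> (\<Sum>j\<in>J. R i j) = 1 / n" "\<And>j. j \<in> J \<Longrightarrow> (\<Sum>i\<in>I. R i j) = 1 / n"
    using coupling_extend[of I J "\<lambda>i j. K (X i) (Z j)" "\<lambda>_. 1 / n" "\<lambda>_. 1 / n"] fin row col n by auto
  have R0: "0 \<le> R i j" if "i \<in> I" "j \<in> J" for i j
    using p XZ that m0 by (intro order_trans[OF _ R(1)]) (auto simp: K_def)
  have pointwise: "p u v * C u v - 2 * \<delta> * B \<le> n * q1 u * (n * q2 v * (K u v * C u v))"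
    if uv: "u \<in> U" "v \<in> V" for u v
  proof -
    \<comment> \<open>Scaling by \<open>q / m\<close> loses the fraction \<open>(m - q) / m\<close>
      of a mass that is at most \<open>m\<close>, hence at most \<open>m - q\<close>. If
      \<open>m = 0\<close>, there is no mass to lose.\<close>
    have d: "p u v * (1 - q / m) \<le> \<delta>" if "p u v \<le> m" "m - q \<le> \<delta>" "0 \<le> q" "q \<le> m" for q m
    proof (cases "m = 0")
      case True
      then show ?thesis using that by auto
    next
      case False
      then have "m > 0" using that by auto
      have "p u v * (1 - q / m) \<le> m * (1 - q / m)"
        using that ratio by (intro mult_right_mono) auto
      also have "\<dots> = m - q" using \<open>m > 0\<close> by (simp add: field_simps)
      finally show ?thesis using that by simp
    qed
    let ?a = "q1 u / m1 u" and ?b = "q2 v / m2 v"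
    have "p u v * (1 - ?a) \<le> \<delta>" "p u v * (1 - ?b) \<le> \<delta>"
      using q0 m0 m\<delta>[OF uv] pm[OF uv] by (auto intro!: d intro: order_trans)
    \<comment> \<open>This is \<open>1 - a b \<le> (1 - a) + (1 - b)\<close> multiplied by the mass,
      so each marginal contributes one \<open>\<delta>\<close> to the loss.\<close>
    moreover have "p u v * ((1 - ?a) * (1 - ?b)) \<ge> 0"
      using ratios p uv by (intro mult_nonneg_nonneg) auto
    ultimately have "p u v - p u v * ?a * ?b \<le> 2 * \<delta>" by (simp add: algebra_simps)
    \<comment> \<open>The loss is nonnegative, hence so is \<open>2 * \<delta>\<close>; the product
      bound with \<open>C u v \<le> B\<close> uses this sign.\<close>
    moreover have "p u v * ?a * ?b \<le> p u v"
      unfolding mult.assoc using ratios p uv by (intro mult_left_le mult_le_one) auto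
    ultimately have "(p u v - p u v * ?a * ?b) * C u v \<le> 2 * \<delta> * B"
      using C by (intro mult_mono) auto
    moreover have "n * q1 u * (n * q2 v * (K u v * C u v)) = p u v * ?a * ?b * C u v"
      using n by (simp add: K_def power2_eq_square)
    ultimately show ?thesis by (simp add: algebra_simps)
  qed
  have "(\<Sum>u\<in>U. \<Sum>v\<in>V. p u v * C u v) - 2 * \<delta> * B * card U * card V
      = (\<Sum>u\<in>U. \<Sum>v\<in>V. p u v * C u v - 2 * \<delta> * B)"
    by (simp add: sum_subtractf)
  also have "\<dots> \<le> (\<Sum>u\<in>U. \<Sum>v\<in>V. n * q1 u * (n * q2 v * (K u v * C u v)))"
    by (intro sum_mono pointwise)
  also have "\<dots> = (\<Sum>u\<in>U. n * q1 u * (\<Sum>j\<in>J. K u (Z j) * C u (Z j)))"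
    using cnt2[of "\<lambda>v. K u v * C u v" for u] by (simp add: sum_distrib_left)
  also have "\<dots> = (\<Sum>i\<in>I. \<Sum>j\<in>J. K (X i) (Z j) * C (X i) (Z j))"
    by (rule cnt1[symmetric])
  also have "\<dots> \<le> (\<Sum>i\<in>I. \<Sum>j\<in>J. R i j * C (X i) (Z j))"
    using R C by (intro sum_mono mult_right_mono) auto
  finally show ?thesis
    using R R0 by (intro that[of R]) auto
qed

subsection \<open>Periodic approximation of invariant measures\<close>

lemma invariant_probsD:
  assumes "\<mu> \<in> invariant_probs"
  shows "\<mu> \<in> borel_probs" "distr \<mu> borel shift = \<mu>"
  using assms by (auto simp: invariant_probs_def shift_invariant_def)

lemma continuous_on_shift: "continuous_on UNIV shift"
  unfolding shift_def by (intro continuous_on_coordinatewise_then_product continuous_on_product_coordinates)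

lemma measurable_shift [measurable]: "shift \<in> borel_measurable borel"
  by (rule borel_measurable_continuous_onI[OF continuous_on_shift])

lemma measurable_shift_pow [measurable]: "(shift ^^ r) \<in> borel_measurable borel"
  by (induction r) (auto intro: measurable_comp)

lemma borel_measurable_local:
  assumes "\<And>x. f (trunc L x) = f x"
  shows "f \<in> borel_measurable borel"
  by (rule borel_measurable_continuous_onI[OF continuous_on_local[of f L, OF assms]])

lemma distr_shift_pow:
  assumes "\<mu> \<in> invariant_probs"
  shows "distr \<mu> borel (shift ^^ r) = \<mu>"
proof (induction r)
  case 0
  then show ?case
    using invariant_probsD[OF assms] by (simp add: distr_id2 borel_probs_simps)
next
  case (Suc r)
  note m = borel_probs_measurable[OF invariant_probsD(1)[OF assms], of borel]
  have "distr \<mu> borel (shift ^^ Suc r) = distr (distr \<mu> borel (shift ^^ r)) borel shift"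
    by (subst distr_distr) (auto simp: m)
  then show ?case
    using Suc invariant_probsD(2)[OF assms] by (simp add: o_def)
qed

section \<open>Birkhoff sums and averages over words\<close>

definition birkhoff_sum :: "(bseq \<Rightarrow> real) \<Rightarrow> nat \<Rightarrow> bseq \<Rightarrow> real" where
  "birkhoff_sum f M x = (\<Sum>r<M. f ((shift ^^ r) x))"

lemma sum_lessThan_add:
  fixes f :: "nat \<Rightarrow> 'a::comm_monoid_add"
  shows "sum f {..<m + k} = sum f {..<m} + (\<Sum>i<k. f (m + i))"
  by (induction k) (auto simp: add.assoc)

lemma birkhoff_sum_add: "birkhoff_sum f (m + k) x = birkhoff_sum f m x + birkhoff_sum f k ((shift ^^ m) x)"
proof -
  have "(shift ^^ (m + r)) x = (shift ^^ r) ((shift ^^ m) x)" for r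
    by (simp add: funpow_add add.commute[of m])
  then show ?thesis by (simp add: birkhoff_sum_def sum_lessThan_add)
qed

lemma birkhoff_sum_mult:
  "birkhoff_sum f (K * M) x = (\<Sum>k<K. birkhoff_sum f M ((shift ^^ (k * M)) x))"
  by (induction K) (auto simp: birkhoff_sum_add add.commute[of M] birkhoff_sum_def[of _ 0])

lemma birkhoff_sum_bounds:
  assumes "\<And>x. 0 \<le> f x" "\<And>x. f x \<le> 1"
  shows "0 \<le> birkhoff_sum f M x" "birkhoff_sum f M x \<le> M"
  using assms sum_bounded_above[of "{..<M}" "\<lambda>r. f ((shift ^^ r) x)" 1]
  by (auto simp: birkhoff_sum_def intro: sum_nonneg)

text \<open>The window of \<open>f\<close> at time \<open>r\<close> covers the coordinates from
  \<open>r\<close> to \<open>r + L - 1\<close>. Only the last \<open>L\<close> of the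
  \<open>M\<close> times look beyond the common prefix, and each of them costs at most 1.\<close>

lemma birkhoff_sum_local:
  assumes f: "\<And>x. f (trunc L x) = f x" "\<And>x. 0 \<le> f x" "\<And>x. f x \<le> 1"
    and xy: "trunc M x = trunc M y"
  shows "\<bar>birkhoff_sum f M x - birkhoff_sum f M y\<bar> \<le> L"
proof -
  have "\<bar>birkhoff_sum f M x - birkhoff_sum f M y\<bar> = \<bar>\<Sum>r<M. f ((shift ^^ r) x) - f ((shift ^^ r) y)\<bar>"
    by (simp add: birkhoff_sum_def sum_subtractf)
  also have "\<dots> \<le> (\<Sum>r<M. \<bar>f ((shift ^^ r) x) - f ((shift ^^ r) y)\<bar>)" by (rule sum_abs)
  also have "\<dots> \<le> (\<Sum>r<M. if M - L \<le> r then 1 else 0)"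
  proof (rule sum_mono)
    fix r assume "r \<in> {..<M}"
    have *: "\<bar>f a - f b\<bar> \<le> 1" for a b using f(2,3)[of a] f(2,3)[of b] by linarith
    have "f ((shift ^^ r) x) = f ((shift ^^ r) y)" if "r < M - L"
    proof -
      have "trunc L ((shift ^^ r) x) = trunc L ((shift ^^ r) y)"
        using that xy by (auto simp: trunc_eq_iff funpow_shift)
      then show ?thesis using f(1) by metis
    qed
    then show "\<bar>f ((shift ^^ r) x) - f ((shift ^^ r) y)\<bar> \<le> (if M - L \<le> r then 1 else 0)"
      using * by auto
  qed
  also have "\<dots> = card {r. r < M \<and> M - L \<le> r}"
    by (simp add: sum.If_cases Int_def)
  \<comment> \<open>The subtraction is truncated: for \<open>L > M\<close> the interval consists of
    all \<open>M\<close> times, still at most \<open>L\<close> of them.\<close>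
  also have "{r. r < M \<and> M - L \<le> r} = {M - L..<M}" by auto
  finally show ?thesis by simp
qed

text \<open>By invariance all \<open>M\<close> terms of the Birkhoff sum have the same integral, so
  its integral is \<open>M\<close> times that of \<open>f\<close>. Replacing a point by its
  \<open>M\<close>-word changes the Birkhoff sum by at most \<open>L\<close>, by
  \<open>birkhoff_sum_local\<close>.\<close>

lemma integral_word_average:
  assumes \<mu>: "\<mu> \<in> invariant_probs"
    and f: "\<And>x. f (trunc L x) = f x" "\<And>x. 0 \<le> f x" "\<And>x. f x \<le> 1"
  shows "\<bar>M * integral\<^sup>L \<mu> f - (\<Sum>w\<in>range (trunc M). measure \<mu> {x. trunc M x = w} * birkhoff_sum f M w)\<bar> \<le> L"
proof -
  note \<mu>' = invariant_probsD[OF \<mu>]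
  note m = borel_probs_measurable[OF \<mu>'(1)]
  interpret prob_space \<mu> by (rule borel_probs_simps[OF \<mu>'(1)])
  note [measurable] = borel_measurable_local[of f L, OF f(1)]
  have int: "integrable \<mu> (\<lambda>x. f ((shift ^^ r) x))" for r
    using f by (intro integrable_const_bound[of _ 1]) (auto simp: m)
  have eq: "(\<integral>x. f ((shift ^^ r) x) \<partial>\<mu>) = integral\<^sup>L \<mu> f" for r
    using integral_distr[of "shift ^^ r" \<mu> borel f] distr_shift_pow[OF \<mu>, of r] by (simp add: m)
  have intB: "integrable \<mu> (birkhoff_sum f M)" "M * integral\<^sup>L \<mu> f = integral\<^sup>L \<mu> (birkhoff_sum f M)"
    unfolding birkhoff_sum_def[abs_def] using int eq by auto
  have mt: "(\<lambda>x. birkhoff_sum f M (trunc M x)) \<in> borel_measurable \<mu>"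
    unfolding m by (rule borel_measurable_local[of _ M]) (simp add: trunc_trunc)
  have intT: "integrable \<mu> (\<lambda>x. birkhoff_sum f M (trunc M x))"
    using birkhoff_sum_bounds[of f] f mt by (intro integrable_const_bound[of _ M]) auto
  have "(\<Sum>w\<in>range (trunc M). measure \<mu> {x. trunc M x = w} * birkhoff_sum f M w)
      = (\<integral>x. birkhoff_sum f M (trunc M x) \<partial>\<mu>)"
    using integral_finite_range[of \<mu> "range (trunc M)" "trunc M" "birkhoff_sum f M"]
      borel_open[OF open_cylinder] finite_range_trunc
    by (simp add: borel_probs_simps[OF \<mu>'(1)] prob_space_axioms)
  then have "\<bar>M * integral\<^sup>L \<mu> f - (\<Sum>w\<in>range (trunc M). measure \<mu> {x. trunc M x = w} * birkhoff_sum f M w)\<bar>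
      = \<bar>\<integral>x. birkhoff_sum f M x - birkhoff_sum f M (trunc M x) \<partial>\<mu>\<bar>"
    using intB intT by simp
  also have "\<dots> \<le> (\<integral>x. \<bar>birkhoff_sum f M x - birkhoff_sum f M (trunc M x)\<bar> \<partial>\<mu>)"
    by (rule integral_abs_bound)
  also have "\<dots> \<le> (\<integral>x. L \<partial>\<mu>)"
    using intB intT birkhoff_sum_local[of f L, OF f, of M] by (intro integral_mono) (auto simp: trunc_trunc)
  finally show ?thesis by (simp add: prob_space)
qed

text \<open>\<open>g\<close> lists the elements of \<open>W\<close> with multiplicities
  \<open>k\<close>. Quantifying over \<open>F\<close> inside the existential lets one list serve all
  test functions.\<close>

lemma ex_enumeration_with_counts:
  fixes k :: "'a \<Rightarrow> nat"
  assumes "finite W"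
  shows "\<exists>g. \<forall>F::'a \<Rightarrow> real. (\<Sum>j<sum k W. F (g j)) = (\<Sum>w\<in>W. k w * F w)"
  using assms
proof induction
  case empty
  then show ?case by simp
next
  case (insert x W)
  then obtain g where g: "\<And>F::'a \<Rightarrow> real. (\<Sum>j<sum k W. F (g j)) = (\<Sum>w\<in>W. k w * F w)" by blast
  let ?g = "\<lambda>j. if j < sum k W then g j else x"
  have "(\<Sum>j<sum k (insert x W). F (?g j)) = (\<Sum>w\<in>insert x W. k w * F w)" for F :: "'a \<Rightarrow> real"
  proof -
    have "(\<Sum>j<sum k W + k x. F (?g j)) = (\<Sum>j<sum k W. F (g j)) + k x * F x"
      by (subst sum_lessThan_add) simp
    then show ?thesis using insert g by (simp add: add.commute)
  qed
  then show ?case by (intro exI[of _ ?g]) blast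
qed

text \<open>
  The periodic point repeats a concatenation of \<open>M\<close>-words, each word \<open>w\<close> occurring
  \<open>\<lfloor>\<mu>[w] n / M\<rfloor>\<close> times. Invariance makes \<open>integral\<^sup>L \<mu> f\<close> the \<open>\<mu>\<close>-average of
  the Birkhoff averages over \<open>M\<close>-words, so neither ergodicity nor an ergodic theorem is needed.
\<close>

lemma periodic_approximation_explicit:
  assumes \<mu>: "\<mu> \<in> invariant_probs" and M: "M > 0" and n: "n > 0"
  obtains y where "(shift ^^ n) y = y"
    "\<And>f L. \<lbrakk>\<And>x. f (trunc L x) = f x; \<And>x. 0 \<le> f x; \<And>x. f x \<le> 1\<rbrakk> \<Longrightarrow>
      \<bar>birkhoff_sum f n y - n * integral\<^sup>L \<mu> f\<bar> \<le> 2 * real n * L / M + 2 * real M * card (range (trunc M))"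
proof -
  let ?W = "range (trunc M)"
  let ?p = "\<lambda>w. measure \<mu> {x. trunc M x = w}"
  interpret prob_space \<mu> by (rule borel_probs_simps invariant_probsD \<mu>)+
  note fin = finite_range_trunc[of M]
  define k where "k w = nat \<lfloor>?p w * n / M\<rfloor>" for w
  define K where "K = sum k ?W"
  have k: "k w \<le> ?p w * n / M" "?p w * n / M \<le> real (k w) + 1" for w
    unfolding k_def by (auto intro: of_nat_floor)
  have sum_p: "sum ?p ?W = 1"
    using integral_finite_range[of \<mu> ?W "trunc M" "\<lambda>_. 1"] borel_open[OF open_cylinder] fin
      borel_probs_simps[OF invariant_probsD(1)[OF \<mu>]] prob_space by simp
  have sum_pn: "(\<Sum>w\<in>?W. ?p w * n / M) = n / M"
    using sum_p by (simp add: sum_divide_distrib[symmetric] sum_distrib_right[symmetric])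
  have "real K \<le> n / M"
    using sum_mono[of ?W "\<lambda>w. real (k w)" "\<lambda>w. ?p w * n / M"] k sum_pn by (simp add: K_def)
  then have "real (K * M) \<le> n" using M by (simp add: field_simps)
  then have KM: "K * M \<le> n" by (simp only: of_nat_le_iff)
  have "(\<Sum>w\<in>?W. ?p w * n / M) \<le> (\<Sum>w\<in>?W. real (k w) + 1)"
    by (intro sum_mono k)
  then have "n / M \<le> K + card ?W"
    using sum_pn by (simp add: K_def sum.distrib)
  \<comment> \<open>Each floor drops less than one copy of a word, so at most \<open>card ?W\<close>
    blocks of length \<open>M\<close> are missing from a period.\<close>
  then have rest: "n \<le> K * M + M * real (card ?W)" using M by (simp add: field_simps)
  obtain g where g: "\<And>F::bseq \<Rightarrow> real. (\<Sum>j<K. F (g j)) = (\<Sum>w\<in>?W. k w * F w)"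
    using ex_enumeration_with_counts[OF fin, of k] unfolding K_def by blast
  \<comment> \<open>\<open>i mod n\<close> forces the period \<open>n\<close>; the quotient and
    remainder by \<open>M\<close> select the block and the letter in it. Blocks with index at least
    \<open>K\<close> carry unspecified words, and this tail is controlled only through its
    length.\<close>
  define y where "y i = g (i mod n div M) (i mod n mod M)" for i
  have per: "(shift ^^ n) y = y"
    by (simp add: fun_eq_iff funpow_shift y_def)
  have block: "trunc M ((shift ^^ (j * M)) y) = trunc M (g j)" if "j < K" for j
  proof -
    have "i + j * M < n" if "i < M" for i
    proof -
      have "i + j * M < Suc j * M" using that by simp
      also have "\<dots> \<le> K * M" using \<open>j < K\<close> by (intro mult_right_mono) auto
      also have "\<dots> \<le> n" using KM by simp
      finally show ?thesis .
    qed
    then show ?thesis by (auto simp: trunc_eq_iff funpow_shift y_def)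
  qed
  have "\<bar>birkhoff_sum f n y - n * integral\<^sup>L \<mu> f\<bar> \<le> 2 * real n * L / M + 2 * real M * card ?W"
    if f: "\<And>x. f (trunc L x) = f x" "\<And>x. 0 \<le> f x" "\<And>x. f x \<le> 1" for f L
  proof -
    let ?S = "birkhoff_sum f M"
    have n_eq: "n = K * M + (n - K * M)" using KM by simp
    have tail: "0 \<le> birkhoff_sum f (n - K * M) z" "birkhoff_sum f (n - K * M) z \<le> M * card ?W" for z
    proof -
      have "real (n - K * M) \<le> M * card ?W" using rest KM by (simp add: of_nat_diff)
      then show "birkhoff_sum f (n - K * M) z \<le> M * card ?W" "0 \<le> birkhoff_sum f (n - K * M) z"
        using birkhoff_sum_bounds[of f "n - K * M" z] f by auto
    qed
    \<comment> \<open>Four errors follow. The tail (1) and the rounding of the counts (3) cost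
      \<open>M * card ?W\<close> each; the windows crossing block ends (2) and the passage from
      \<open>\<mu>\<close> to its word average (4) cost \<open>n / M * L\<close> each.\<close>
    have "birkhoff_sum f n y = (\<Sum>j<K. ?S ((shift ^^ (j * M)) y)) + birkhoff_sum f (n - K * M) ((shift ^^ (K * M)) y)"
      using n_eq birkhoff_sum_add[of f "K * M" "n - K * M" y] by (simp add: birkhoff_sum_mult)
    then have 1: "\<bar>birkhoff_sum f n y - (\<Sum>j<K. ?S ((shift ^^ (j * M)) y))\<bar> \<le> M * card ?W"
      using tail[of "(shift ^^ (K * M)) y"] by simp
    have "\<bar>(\<Sum>j<K. ?S ((shift ^^ (j * M)) y)) - (\<Sum>j<K. ?S (g j))\<bar> \<le> (\<Sum>j<K. \<bar>?S ((shift ^^ (j * M)) y) - ?S (g j)\<bar>)"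
      by (simp add: sum_subtractf[symmetric] sum_abs)
    also have "\<dots> \<le> (\<Sum>j<K. real L)"
      using block birkhoff_sum_local[of f L, OF f] by (intro sum_mono) auto
    also have "\<dots> \<le> n / M * L"
      using \<open>K \<le> n / M\<close> by (simp add: mult_right_mono del: times_divide_eq_left)
    finally have 2: "\<bar>(\<Sum>j<K. ?S ((shift ^^ (j * M)) y)) - (\<Sum>w\<in>?W. k w * ?S w)\<bar> \<le> n / M * L"
      using g by simp
    have "\<bar>(\<Sum>w\<in>?W. k w * ?S w) - (\<Sum>w\<in>?W. ?p w * n / M * ?S w)\<bar> \<le> (\<Sum>w\<in>?W. \<bar>(k w - ?p w * n / M) * ?S w\<bar>)"
      by (simp add: sum_subtractf[symmetric] left_diff_distrib sum_abs)
    also have "\<dots> \<le> (\<Sum>w\<in>?W. 1 * real M)"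
    proof (rule sum_mono)
      fix w
      have "\<bar>k w - ?p w * n / M\<bar> \<le> 1" using k[of w] by linarith
      moreover have "\<bar>?S w\<bar> \<le> M" using birkhoff_sum_bounds[of f M w] f by simp
      ultimately show "\<bar>(k w - ?p w * n / M) * ?S w\<bar> \<le> 1 * real M"
        unfolding abs_mult by (intro mult_mono) auto
    qed
    finally have 3: "\<bar>(\<Sum>w\<in>?W. k w * ?S w) - (\<Sum>w\<in>?W. ?p w * n / M * ?S w)\<bar> \<le> M * card ?W"
      by (simp add: mult.commute)
    have "n / M * \<bar>M * integral\<^sup>L \<mu> f - (\<Sum>w\<in>?W. ?p w * ?S w)\<bar> \<le> n / M * L"
      by (intro mult_left_mono integral_word_average[OF \<mu>, of f L, OF f]) auto
    then have "\<bar>n / M * (M * integral\<^sup>L \<mu> f - (\<Sum>w\<in>?W. ?p w * ?S w))\<bar> \<le> n / M * L"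
      by (simp add: abs_mult)
    moreover have "n / M * (M * integral\<^sup>L \<mu> f - (\<Sum>w\<in>?W. ?p w * ?S w))
        = n * integral\<^sup>L \<mu> f - (\<Sum>w\<in>?W. ?p w * n / M * ?S w)"
      using M by (simp add: right_diff_distrib sum_distrib_left mult_ac)
    ultimately have 4: "\<bar>n * integral\<^sup>L \<mu> f - (\<Sum>w\<in>?W. ?p w * n / M * ?S w)\<bar> \<le> n / M * L"
      by (simp only:)
    have "\<bar>birkhoff_sum f n y - n * integral\<^sup>L \<mu> f\<bar> \<le> 2 * (n / M * L) + 2 * (M * card ?W)"
      using 1 2 3 4 by linarith
    then show ?thesis by (simp add: mult_ac)
  qed
  then show ?thesis using that per by blast
qed

text \<open>The explicit bound is applied to cylinder indicators, whose Birkhoff sums count visits.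
  First \<open>M\<close> is fixed so that the word-boundary error is at most
  \<open>\<delta> / 2\<close>; then \<open>n\<close> grows until the remaining error, constant in
  \<open>n\<close> before division, is below \<open>\<delta> / 2\<close>.\<close>

lemma periodic_approximation:
  assumes \<mu>: "\<mu> \<in> invariant_probs" and \<delta>: "\<delta> > 0"
  shows "\<forall>\<^sub>F n in sequentially. \<exists>y. (shift ^^ n) y = y \<and>
    (\<forall>u. \<bar>card {i\<in>{..<n}. trunc L ((shift ^^ i) y) = u} / n - measure \<mu> {x. trunc L x = u}\<bar> \<le> \<delta>)"
proof -
  define M where "M = Suc (nat \<lceil>4 * L / \<delta>\<rceil>)"
  have M: "M > 0" "4 * L / \<delta> \<le> M" unfolding M_def by linarith+
  let ?B = "2 * real M * card (range (trunc M))"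
  have "(\<lambda>n. ?B / real n) \<longlonglongrightarrow> 0"
    by (rule lim_const_over_n)
  then have "\<forall>\<^sub>F n in sequentially. ?B / real n < \<delta> / 2"
    using \<delta> by (intro order_tendstoD(2)) auto
  then show ?thesis
    using eventually_gt_at_top[of 0]
  proof eventually_elim
    case (elim n)
    obtain y where y: "(shift ^^ n) y = y"
      "\<And>f L. \<lbrakk>\<And>x. f (trunc L x) = f x; \<And>x. 0 \<le> f x; \<And>x. f x \<le> 1\<rbrakk> \<Longrightarrow>
        \<bar>birkhoff_sum f n y - n * integral\<^sup>L \<mu> f\<bar> \<le> 2 * real n * L / M + ?B"
      using periodic_approximation_explicit[OF \<mu> M(1) elim(2)] by blast
    have "\<bar>card {i\<in>{..<n}. trunc L ((shift ^^ i) y) = u} / n - measure \<mu> {x. trunc L x = u}\<bar> \<le> \<delta>" for u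
    proof -
      let ?f = "indicator {x. trunc L x = u} :: bseq \<Rightarrow> real"
      have b: "birkhoff_sum ?f n y = card {i\<in>{..<n}. trunc L ((shift ^^ i) y) = u}"
        unfolding birkhoff_sum_def by (simp add: indicator_def sum.If_cases Int_def)
      have i: "integral\<^sup>L \<mu> ?f = measure \<mu> {x. trunc L x = u}"
        using borel_probs_simps[OF invariant_probsD(1)[OF \<mu>]] by simp
      have "\<bar>birkhoff_sum ?f n y - n * integral\<^sup>L \<mu> ?f\<bar> \<le> 2 * real n * L / M + ?B"
        by (rule y(2)) (auto simp: indicator_def trunc_trunc)
      then have "\<bar>birkhoff_sum ?f n y - n * integral\<^sup>L \<mu> ?f\<bar> / n \<le> (2 * real n * L / M + ?B) / n"
        by (intro divide_right_mono) auto
      also have "\<dots> = 2 * real L / M + ?B / n"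
        using elim by (simp add: add_divide_distrib)
      also have "\<dots> \<le> \<delta>"
      proof -
        have "2 * real L / M \<le> \<delta> / 2"
          using M \<delta> by (simp add: field_simps)
        then show ?thesis using elim(1) by linarith
      qed
      also have "\<bar>birkhoff_sum ?f n y - n * integral\<^sup>L \<mu> ?f\<bar> / n = \<bar>birkhoff_sum ?f n y / n - integral\<^sup>L \<mu> ?f\<bar>"
      proof -
        have "birkhoff_sum ?f n y / n - integral\<^sup>L \<mu> ?f = (birkhoff_sum ?f n y - n * integral\<^sup>L \<mu> ?f) / n"
          using elim by (simp add: diff_divide_distrib)
        then show ?thesis by (simp only: abs_divide abs_of_nat)
      qed
      finally show ?thesis by (simp only: b i)
    qed
    then show ?case using y(1) by blast
  qed
qed

subsection \<open>Plans between periodic orbits\<close>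

lemma integrable_return:
  fixes f :: "'a \<Rightarrow> real"
  assumes "f \<in> borel_measurable M" "x \<in> space M"
  shows "integrable (return M x) f"
  using assms by (auto simp: integrable_iff_bounded nn_integral_return)

text \<open>A point fixed by \<open>shift ^^ n\<close> is determined by its first \<open>n\<close>
  letters.\<close>

lemma card_Fix_le:
  assumes n: "1 \<le> n"
  shows "card (Fix n) \<le> 2 ^ n"
proof -
  let ?g = "\<lambda>S. orbit_measure n (\<lambda>i. i mod n \<in> S)"
  have "Fix n \<subseteq> ?g ` Pow {..<n}"
  proof
    fix \<mu> assume "\<mu> \<in> Fix n"
    then obtain y where y: "(shift ^^ n) y = y" "\<mu> = orbit_measure n y" by (auto simp: Fix_def)
    have "y (i + k * n) = y i" for i k
    proof (induction k)
      case (Suc k)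
      have "y (i + Suc k * n) = y (i + k * n)"
        using fun_cong[OF y(1), of "i + k * n"] by (simp add: funpow_shift add_ac)
      with Suc show ?case by simp
    qed simp
    from this[of "i mod n" "i div n" for i] have "y i = y (i mod n)" for i by simp
    then have "y = (\<lambda>i. i mod n \<in> {i. i < n \<and> y i})" using n by (auto simp: fun_eq_iff)
    then show "\<mu> \<in> ?g ` Pow {..<n}"
      using y(2) by (intro image_eqI[where x = "{i. i < n \<and> y i}"]) auto
  qed
  then have "card (Fix n) \<le> card (Pow {..<n})" by (rule surj_card_le[rotated]) simp
  then show ?thesis by (simp add: card_Pow)
qed

lemma integral_orbit_measure:
  assumes "1 \<le> n" "continuous_on UNIV (w :: bseq \<Rightarrow> real)"
  shows "integral\<^sup>L (orbit_measure n y) w = (\<Sum>i<n. w ((shift ^^ i) y)) / n"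
  unfolding orbit_measure_def
  using borel_measurable_continuous_onI[OF assms(2)]
  by (subst integral_mixture(2)) (auto simp: integral_return sum_divide_distrib intro!: integrable_return)

text \<open>Shifting the orbit sum trades the term at time 0 for the one at time \<open>n\<close>,
  and these agree by periodicity.\<close>

lemma integral_orbit_measure_shift:
  assumes "1 \<le> n" "(shift ^^ n) y = y" "continuous_on UNIV (w :: bseq \<Rightarrow> real)"
  shows "integral\<^sup>L (orbit_measure n y) (\<lambda>x. w (shift x)) = integral\<^sup>L (orbit_measure n y) w"
proof -
  have "(\<Sum>i<n. w ((shift ^^ Suc i) y)) = (\<Sum>i<n. w ((shift ^^ i) y))"
    using sum.lessThan_Suc_shift[of "\<lambda>i. w ((shift ^^ i) y)" n] assms(2) by simp
  moreover have "continuous_on UNIV (\<lambda>x. w (shift x))"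
    using continuous_on_compose2[OF assms(3) continuous_on_shift] by simp
  ultimately show ?thesis
    using assms integral_orbit_measure[of n "\<lambda>x. w (shift x)" y] by (simp add: integral_orbit_measure)
qed

text \<open>The matrix is indexed by times rather than by orbit points, so orbits whose least period
  is a proper divisor of \<open>n\<close> need no separate treatment.\<close>

definition orbit_coupling ::
    "nat \<Rightarrow> (nat \<Rightarrow> nat \<Rightarrow> real) \<Rightarrow> bseq \<Rightarrow> bseq \<Rightarrow> (bseq \<times> bseq) measure" where
  "orbit_coupling n R y z =
     mixture ({..<n} \<times> {..<n}) (\<lambda>(i, j). R i j) (\<lambda>(i, j). return borel ((shift ^^ i) y, (shift ^^ j) z))"

lemma measurable_fst_borel: "(fst :: bseq \<times> bseq \<Rightarrow> bseq) \<in> borel_measurable borel"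
  and measurable_snd_borel: "(snd :: bseq \<times> bseq \<Rightarrow> bseq) \<in> borel_measurable borel"
  by (intro borel_measurable_continuous_onI continuous_intros)+

lemma orbit_coupling_in_plans:
  assumes n: "1 \<le> n" and R: "\<And>i j. i < n \<Longrightarrow> j < n \<Longrightarrow> 0 \<le> R i j"
    and row: "\<And>i. i < n \<Longrightarrow> (\<Sum>j<n. R i j) = 1 / n" and col: "\<And>j. j < n \<Longrightarrow> (\<Sum>i<n. R i j) = 1 / n"
  shows "orbit_coupling n R y z \<in> plans (orbit_measure n y) (orbit_measure n z)"
proof -
  let ?\<rho> = "orbit_coupling n R y z"
  have sets: "sets ?\<rho> = sets borel" "space ?\<rho> = UNIV" by (simp_all add: orbit_coupling_def)
  have m: "measurable ?\<rho> N = measurable borel N" for N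
    using sets by (intro measurable_cong_sets) auto
  have em: "emeasure ?\<rho> A = (\<Sum>i<n. \<Sum>j<n. ennreal (R i j) * indicator A ((shift ^^ i) y, (shift ^^ j) z))"
    if "A \<in> sets borel" for A
  proof -
    have "emeasure ?\<rho> A = (\<Sum>(i, j)\<in>{..<n} \<times> {..<n}. ennreal (R i j) * indicator A ((shift ^^ i) y, (shift ^^ j) z))"
      unfolding orbit_coupling_def using that
      by (subst emeasure_mixture) (auto intro!: sum.cong simp del: sum_mult_indicator)
    then show ?thesis by (simp only: sum.cartesian_product)
  qed
  have eo: "emeasure (orbit_measure n x) A = (\<Sum>i<n. ennreal (1 / n) * indicator A ((shift ^^ i) x))"
    if "A \<in> sets borel" for A x
    using that unfolding orbit_measure_def by (subst emeasure_mixture) auto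
  have fst: "distr ?\<rho> borel fst = orbit_measure n y"
  proof (rule measure_eqI)
    fix A assume "A \<in> sets (distr ?\<rho> borel fst)"
    then have A: "A \<in> sets borel" by simp
    have A': "fst -` A \<in> sets (borel :: (bseq \<times> bseq) measure)"
      using measurable_sets[OF measurable_fst_borel A] by simp
    have "emeasure (distr ?\<rho> borel fst) A = emeasure ?\<rho> (fst -` A)"
      using A by (subst emeasure_distr) (auto simp: m measurable_fst_borel sets)
    also have "\<dots> = (\<Sum>i<n. (\<Sum>j<n. ennreal (R i j)) * indicator A ((shift ^^ i) y))"
      by (simp add: em[OF A'] sum_distrib_right indicator_def)
    also have "\<dots> = (\<Sum>i<n. ennreal (1 / n) * indicator A ((shift ^^ i) y))"
      using R row by (intro sum.cong refl) (subst sum_ennreal, auto)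
    finally show "emeasure (distr ?\<rho> borel fst) A = emeasure (orbit_measure n y) A"
      by (simp add: eo[OF A])
  qed (simp add: orbit_measure_def)
  have snd: "distr ?\<rho> borel snd = orbit_measure n z"
  proof (rule measure_eqI)
    fix A assume "A \<in> sets (distr ?\<rho> borel snd)"
    then have A: "A \<in> sets borel" by simp
    have A': "snd -` A \<in> sets (borel :: (bseq \<times> bseq) measure)"
      using measurable_sets[OF measurable_snd_borel A] by simp
    have "emeasure (distr ?\<rho> borel snd) A = emeasure ?\<rho> (snd -` A)"
      using A by (subst emeasure_distr) (auto simp: m measurable_snd_borel sets)
    also have "\<dots> = (\<Sum>j<n. (\<Sum>i<n. ennreal (R i j)) * indicator A ((shift ^^ j) z))"
      by (subst em[OF A'], subst sum.swap) (simp add: sum_distrib_right indicator_def)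
    also have "\<dots> = (\<Sum>j<n. ennreal (1 / n) * indicator A ((shift ^^ j) z))"
      using R col by (intro sum.cong refl) (subst sum_ennreal, auto)
    finally show "emeasure (distr ?\<rho> borel snd) A = emeasure (orbit_measure n z) A"
      by (simp add: eo[OF A])
  qed (simp add: orbit_measure_def)
  have "emeasure ?\<rho> UNIV = (\<Sum>i<n. \<Sum>j<n. ennreal (R i j))"
    by (subst em) auto
  also have "\<dots> = (\<Sum>i<n. ennreal (1 / n))"
    using R row by (intro sum.cong refl) (subst sum_ennreal, auto)
  also have "\<dots> = 1" using n by (subst sum_ennreal) auto
  finally have "prob_space ?\<rho>" using sets by (intro prob_spaceI) simp
  then show ?thesis using fst snd sets by (simp add: plans_def borel_probs_def)
qed

lemma integral_orbit_coupling:
  assumes "\<And>i j. i < n \<Longrightarrow> j < n \<Longrightarrow> 0 \<le> R i j" "continuous_on UNIV w"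
  shows "integral\<^sup>L (orbit_coupling n R y z) w = (\<Sum>i<n. \<Sum>j<n. R i j * w ((shift ^^ i) y, (shift ^^ j) z))"
  unfolding orbit_coupling_def using assms borel_measurable_continuous_onI[OF assms(2)]
  by (subst integral_mixture(2))
    (auto simp: integral_return sum.cartesian_product split_beta intro!: integrable_return)

text \<open>The error \<open>e\<close> is spent in thirds: replacing \<open>c\<close> by its
  \<open>L\<close>-word version under \<open>\<pi>\<close>, transferring the word distribution to
  the two periodic orbits, and returning from words to \<open>c\<close> along the orbits.\<close>

lemma plan_approximation:
  fixes c :: "bseq \<times> bseq \<Rightarrow> real"
  assumes c: "continuous_on UNIV c" "\<And>z. 0 < c z" and \<pi>: "\<pi> \<in> invariant_plans" and e: "e > 0"
  shows "\<forall>\<^sub>F n in sequentially. \<exists>\<mu>\<in>Fix n. \<exists>\<nu>\<in>Fix n. \<exists>\<rho>\<in>plans \<mu> \<nu>. integral\<^sup>L \<pi> c - e \<le> integral\<^sup>L \<rho> c"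
proof -
  have \<pi>b: "\<pi> \<in> borel_probs" and fst: "distr \<pi> borel fst \<in> invariant_probs" and snd: "distr \<pi> borel snd \<in> invariant_probs"
    using \<pi> by (auto simp: invariant_plans_def)
  note m = borel_probs_measurable[OF \<pi>b]
  interpret prob_space \<pi> by (rule borel_probs_simps[OF \<pi>b])
  obtain L where L: "\<And>x y. \<bar>c (x, y) - c (trunc L x, trunc L y)\<bar> \<le> e / 3"
    using uniform_trunc[OF c(1), of "e / 3"] e by auto
  let ?W = "range (trunc L)"
  note fin = finite_range_trunc[of L]
  define B where "B = Max (c ` (?W \<times> ?W))"
  have B: "c (trunc L x, trunc L y) \<le> B" for x y
    using fin by (auto simp: B_def intro!: Max_ge)
  have "B > 0" using B c(2) less_le_trans by blast
  \<comment> \<open>Solves \<open>2 * \<delta> * B * card ?W * card ?W = e / 3\<close>, the loss in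
    \<open>transfer_coupling\<close>.\<close>
  define \<delta> where "\<delta> = e / (6 * B * card ?W * card ?W)"
  have card: "card ?W > 0" using fin by (simp add: card_gt_0_iff)
  have \<delta>: "\<delta> > 0" "2 * \<delta> * B * card ?W * card ?W = e / 3"
    using card e \<open>B > 0\<close> by (auto simp: \<delta>_def field_simps)
  define p where "p u v = measure \<pi> {z. trunc L (fst z) = u \<and> trunc L (snd z) = v}" for u v
  have cyl: "{z :: bseq \<times> bseq. trunc L (fst z) = u \<and> trunc L (snd z) = v} \<in> sets \<pi>" for u v
  proof -
    have "{z :: bseq \<times> bseq. trunc L (fst z) = u \<and> trunc L (snd z) = v} = {x. trunc L x = u} \<times> {x. trunc L x = v}"
      by auto
    moreover have "open ({x. trunc L x = u} \<times> {x. trunc L x = v})"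
      by (intro open_Times open_cylinder)
    ultimately show ?thesis using borel_probs_simps[OF \<pi>b] by simp
  qed
  have p1: "(\<Sum>v\<in>?W. p u v) = measure (distr \<pi> borel fst) {x. trunc L x = u}" for u
  proof -
    have "measure (distr \<pi> borel fst) {x. trunc L x = u} = measure \<pi> (\<Union>v\<in>?W. {z. trunc L (fst z) = u \<and> trunc L (snd z) = v})"
      by (subst measure_distr) (auto simp: m measurable_fst_borel borel_probs_simps[OF \<pi>b] open_cylinder intro!: arg_cong[where f = "measure \<pi>"])
    also have "\<dots> = (\<Sum>v\<in>?W. p u v)"
      unfolding p_def using fin cyl by (intro finite_measure_finite_Union) (auto simp: disjoint_family_on_def)
    finally show ?thesis by simp
  qed
  have p2: "(\<Sum>u\<in>?W. p u v) = measure (distr \<pi> borel snd) {x. trunc L x = v}" for v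
  proof -
    have "measure (distr \<pi> borel snd) {x. trunc L x = v} = measure \<pi> (\<Union>u\<in>?W. {z. trunc L (fst z) = u \<and> trunc L (snd z) = v})"
      by (subst measure_distr) (auto simp: m measurable_snd_borel borel_probs_simps[OF \<pi>b] open_cylinder intro!: arg_cong[where f = "measure \<pi>"])
    also have "\<dots> = (\<Sum>u\<in>?W. p u v)"
      unfolding p_def using fin cyl by (intro finite_measure_finite_Union) (auto simp: disjoint_family_on_def)
    finally show ?thesis by simp
  qed
  have "(\<integral>z. c (trunc L (fst z), trunc L (snd z)) \<partial>\<pi>) = (\<Sum>w\<in>?W \<times> ?W. measure \<pi> {z \<in> space \<pi>. (trunc L (fst z), trunc L (snd z)) = w} * c w)"
    using cyl fin
    by (intro integral_finite_range prob_space_axioms) (auto simp: borel_probs_simps[OF \<pi>b])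
  then have ic: "(\<integral>z. c (trunc L (fst z), trunc L (snd z)) \<partial>\<pi>) = (\<Sum>u\<in>?W. \<Sum>v\<in>?W. p u v * c (u, v))"
    unfolding sum.cartesian_product by (auto simp: p_def borel_probs_simps[OF \<pi>b] intro!: sum.cong)
  have ct: "continuous_on UNIV (\<lambda>z. c (trunc L (fst z), trunc L (snd z)))"
  proof -
    have "continuous_on UNIV (trunc L)"
      by (rule continuous_on_local[of _ L]) (simp add: trunc_trunc)
    from continuous_on_compose2[OF this continuous_on_fst[OF continuous_on_id]]
      continuous_on_compose2[OF this continuous_on_snd[OF continuous_on_id]]
    have "continuous_on UNIV (\<lambda>z. (trunc L (fst z), trunc L (snd z)))"
      by (intro continuous_on_Pair) auto
    from continuous_on_compose2[OF c(1) this] show ?thesis by simp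
  qed
  have "integral\<^sup>L \<pi> c \<le> (\<integral>z. c (trunc L (fst z), trunc L (snd z)) + e / 3 \<partial>\<pi>)"
  proof (rule integral_mono)
    show "c z \<le> c (trunc L (fst z), trunc L (snd z)) + e / 3" for z
      using L[of "fst z" "snd z"] unfolding prod.collapse by linarith
  qed (use integrable_continuous[OF ct \<pi>b] integrable_continuous[OF c(1) \<pi>b] in auto)
  then have I: "integral\<^sup>L \<pi> c \<le> (\<Sum>u\<in>?W. \<Sum>v\<in>?W. p u v * c (u, v)) + e / 3"
    using integrable_continuous[OF ct \<pi>b] ic by (simp add: prob_space)
  show ?thesis
    using periodic_approximation[OF fst \<delta>(1), of L] periodic_approximation[OF snd \<delta>(1), of L] eventually_ge_at_top[of 1]
  proof eventually_elim
    case (elim n)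
    obtain y where y: "(shift ^^ n) y = y"
      "\<And>u. \<bar>card {i\<in>{..<n}. trunc L ((shift ^^ i) y) = u} / n - (\<Sum>v\<in>?W. p u v)\<bar> \<le> \<delta>"
      using elim(1) p1 by auto
    obtain z where z: "(shift ^^ n) z = z"
      "\<And>v. \<bar>card {i\<in>{..<n}. trunc L ((shift ^^ i) z) = v} / n - (\<Sum>u\<in>?W. p u v)\<bar> \<le> \<delta>"
      using elim(2) p2 by auto
    \<comment> \<open>The arguments are truncated so that \<open>0 \<le> ?C u v \<le> B\<close>
      holds for all points and not only for \<open>L\<close>-words; on words \<open>?C\<close>
      agrees with \<open>c\<close>.\<close>
    let ?C = "\<lambda>u v. c (trunc L u, trunc L v)"
    let ?X = "\<lambda>i. trunc L ((shift ^^ i) y)" and ?Z = "\<lambda>i. trunc L ((shift ^^ i) z)"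
    obtain R where R: "\<And>i j. i \<in> {..<n} \<Longrightarrow> j \<in> {..<n} \<Longrightarrow> 0 \<le> R i j"
      "\<And>i. i \<in> {..<n} \<Longrightarrow> (\<Sum>j<n. R i j) = 1 / n" "\<And>j. j \<in> {..<n} \<Longrightarrow> (\<Sum>i<n. R i j) = 1 / n"
      and RC: "(\<Sum>u\<in>?W. \<Sum>v\<in>?W. p u v * ?C u v) - 2 * \<delta> * B * card ?W * card ?W \<le> (\<Sum>i<n. \<Sum>j<n. R i j * ?C (?X i) (?Z j))"
    proof (rule transfer_coupling[of ?W ?W "{..<n}" "{..<n}" n ?X ?Z p ?C B \<delta>])
      show "0 \<le> ?C u v" "?C u v \<le> B" for u v using B c(2) by (auto simp: less_imp_le)
    qed (use fin elim(3) y z in \<open>auto simp: p_def\<close>)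
    have R0: "0 \<le> R i j" if "i < n" "j < n" for i j using R that by simp
    let ?\<rho> = "orbit_coupling n R y z"
    have "(\<Sum>u\<in>?W. \<Sum>v\<in>?W. p u v * c (u, v)) = (\<Sum>u\<in>?W. \<Sum>v\<in>?W. p u v * ?C u v)"
      by (intro sum.cong refl) (auto simp: trunc_trunc)
    moreover have "(\<Sum>i<n. \<Sum>j<n. R i j * ?C (?X i) (?Z j)) \<le> integral\<^sup>L ?\<rho> c + e / 3"
    proof -
      have "(\<Sum>i<n. \<Sum>j<n. R i j * ?C (?X i) (?Z j)) \<le> (\<Sum>i<n. \<Sum>j<n. R i j * (c ((shift ^^ i) y, (shift ^^ j) z) + e / 3))"
      proof (intro sum_mono mult_left_mono)
        fix i j
        show "?C (?X i) (?Z j) \<le> c ((shift ^^ i) y, (shift ^^ j) z) + e / 3"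
          using L[of "(shift ^^ i) y" "(shift ^^ j) z"] unfolding trunc_trunc[OF order_refl] by linarith
      qed (use R in auto)
      also have "\<dots> = integral\<^sup>L ?\<rho> c + (\<Sum>i<n. (\<Sum>j<n. R i j) * (e / 3))"
        using R0 by (subst integral_orbit_coupling) (auto simp: c distrib_left sum.distrib sum_distrib_right sum_divide_distrib)
      also have "(\<Sum>i<n. (\<Sum>j<n. R i j) * (e / 3)) = e / 3"
        using R(2) elim(3) by simp
      finally show ?thesis .
    qed
    ultimately have "integral\<^sup>L \<pi> c - e \<le> integral\<^sup>L ?\<rho> c"
      using I RC \<delta>(2) by linarith
    moreover have "?\<rho> \<in> plans (orbit_measure n y) (orbit_measure n z)"
      using R elim(3) by (intro orbit_coupling_in_plans) auto
    ultimately show ?case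
      using y(1) z(1) unfolding Fix_def by blast
  qed
qed

section \<open>Near-maximality and shift invariance of the Gibbs averages\<close>

lemma integral_zeta_lower_bound:
  assumes c: "continuous_on UNIV c" and P: "\<And>\<mu> \<nu>. \<mu> \<in> Fix n \<Longrightarrow> \<nu> \<in> Fix n \<Longrightarrow> maximizing_plan c \<mu> \<nu> (P \<mu> \<nu>)"
    and n: "1 \<le> n" and \<beta>: "0 < \<beta>"
    and \<rho>: "\<mu> \<in> Fix n" "\<nu> \<in> Fix n" "\<rho> \<in> plans \<mu> \<nu>"
  shows "integral\<^sup>L \<rho> c - ln 4 / \<beta> \<le> integral\<^sup>L (zeta c P \<beta> n) c"
proof -
  let ?I = "Fix n \<times> Fix n"
  define a where "a = (\<lambda>(\<mu>, \<nu>). integral\<^sup>L (P \<mu> \<nu>) c)"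
  define t where "t = \<beta> * n"
  define Z where "Z = (\<Sum>i\<in>?I. exp (t * a i))"
  have t: "t > 0" using n \<beta> by (simp add: t_def)
  have Z: "Z > 0"
    unfolding Z_def using finite_Fix Fix_nonempty by (intro sum_pos) auto
  have eq: "integral\<^sup>L (zeta c P \<beta> n) c = (\<Sum>i\<in>?I. exp (t * a i) * a i) / Z"
    using P by (subst integral_zeta[OF c])
      (auto simp: maximizing_plan_def plans_def sum.cartesian_product a_def t_def Z_def split_beta)
  have "card ?I \<le> 2 ^ n * 2 ^ n"
    using card_Fix_le[OF n] by (simp add: card_cartesian_product mult_mono)
  also have "\<dots> = (4::nat) ^ n" by (simp flip: power_mult_distrib)
  finally have "real (card ?I) \<le> 4 ^ n" by (metis of_nat_le_iff of_nat_numeral of_nat_power)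
  \<comment> \<open>The Gibbs bound is used with the pair of marginals of \<open>\<rho>\<close> as
    distinguished index and \<open>N = 4 ^ n\<close>; maximality of \<open>P \<mu> \<nu>\<close>
    later compares \<open>a (\<mu>, \<nu>)\<close> with the given \<open>\<rho>\<close>.\<close>
  then have "(t * a (\<mu>, \<nu>) - ln (4 ^ n)) * Z \<le> t * (\<Sum>i\<in>?I. exp (t * a i) * a i)"
    unfolding Z_def using \<rho> by (intro gibbs_lower_bound) (auto simp: finite_Fix)
  then have "(t * a (\<mu>, \<nu>) - ln (4 ^ n)) / t \<le> (\<Sum>i\<in>?I. exp (t * a i) * a i) / Z"
    using t Z by (simp add: field_simps)
  moreover have "(t * a (\<mu>, \<nu>) - ln (4 ^ n)) / t = a (\<mu>, \<nu>) - ln 4 / \<beta>"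
    using n \<beta> by (simp add: t_def ln_realpow field_simps)
  moreover have "integral\<^sup>L \<rho> c \<le> a (\<mu>, \<nu>)"
    using P[OF \<rho>(1,2)] \<rho>(3) by (simp add: a_def maximizing_plan_def)
  ultimately show ?thesis using eq by linarith
qed

text \<open>The marginals of \<open>zeta\<close> are convex combinations of measures in
  \<open>Fix n\<close>. Invariance is expressed through continuous test functions because this form
  survives weak* limits.\<close>

lemma integral_zeta_shift:
  assumes P: "\<And>\<mu> \<nu>. \<mu> \<in> Fix n \<Longrightarrow> \<nu> \<in> Fix n \<Longrightarrow> P \<mu> \<nu> \<in> plans \<mu> \<nu>" and n: "1 \<le> n"
    and w: "continuous_on UNIV (w :: bseq \<Rightarrow> real)"
  shows "(\<integral>x. w (shift (fst x)) \<partial>zeta c P \<beta> n) = (\<integral>x. w (fst x) \<partial>zeta c P \<beta> n)"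
    and "(\<integral>x. w (shift (snd x)) \<partial>zeta c P \<beta> n) = (\<integral>x. w (snd x) \<partial>zeta c P \<beta> n)"
proof -
  have ws: "continuous_on UNIV (\<lambda>x. w (shift x))"
    using continuous_on_compose2[OF w continuous_on_shift] by simp
  have cont: "continuous_on UNIV (\<lambda>x::bseq \<times> bseq. v (fst x))" "continuous_on UNIV (\<lambda>x::bseq \<times> bseq. v (snd x))"
    if "continuous_on UNIV v" for v :: "bseq \<Rightarrow> real"
    using continuous_on_compose2[OF that continuous_on_fst[OF continuous_on_id]]
      continuous_on_compose2[OF that continuous_on_snd[OF continuous_on_id]] by auto
  have Pb: "P \<mu> \<nu> \<in> borel_probs" if "\<mu> \<in> Fix n" "\<nu> \<in> Fix n" for \<mu> \<nu>
    using P[OF that] by (simp add: plans_def)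
  have marg: "(\<integral>x. v (fst x) \<partial>P \<mu> \<nu>) = integral\<^sup>L \<mu> v" "(\<integral>x. v (snd x) \<partial>P \<mu> \<nu>) = integral\<^sup>L \<nu> v"
    if "\<mu> \<in> Fix n" "\<nu> \<in> Fix n" "continuous_on UNIV v" for \<mu> \<nu> and v :: "bseq \<Rightarrow> real"
  proof -
    note m = borel_probs_measurable[OF Pb[OF that(1,2)]] measurable_fst_borel measurable_snd_borel
    have "integral\<^sup>L (distr (P \<mu> \<nu>) borel fst) v = (\<integral>x. v (fst x) \<partial>P \<mu> \<nu>)"
      "integral\<^sup>L (distr (P \<mu> \<nu>) borel snd) v = (\<integral>x. v (snd x) \<partial>P \<mu> \<nu>)"
      using borel_measurable_continuous_onI[OF that(3)] by (auto intro!: integral_distr simp: m)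
    then show "(\<integral>x. v (fst x) \<partial>P \<mu> \<nu>) = integral\<^sup>L \<mu> v" "(\<integral>x. v (snd x) \<partial>P \<mu> \<nu>) = integral\<^sup>L \<nu> v"
      using P[OF that(1,2)] by (auto simp: plans_def)
  qed
  have inv: "integral\<^sup>L \<mu> (\<lambda>x. w (shift x)) = integral\<^sup>L \<mu> w" if "\<mu> \<in> Fix n" for \<mu>
    using that integral_orbit_measure_shift[OF n _ w] by (auto simp: Fix_def)
  show "(\<integral>x. w (shift (fst x)) \<partial>zeta c P \<beta> n) = (\<integral>x. w (fst x) \<partial>zeta c P \<beta> n)"
    by (simp add: integral_zeta cont[OF w] cont[OF ws] Pb marg[OF _ _ w] marg[OF _ _ ws] inv cong: sum.cong)
  show "(\<integral>x. w (shift (snd x)) \<partial>zeta c P \<beta> n) = (\<integral>x. w (snd x) \<partial>zeta c P \<beta> n)"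
    by (simp add: integral_zeta cont[OF w] cont[OF ws] Pb marg[OF _ _ w] marg[OF _ _ ws] inv cong: sum.cong)
qed

text \<open>Cylinders are clopen, so their indicators are admissible continuous test functions, and
  a Borel probability measure is determined by its cylinder values.\<close>

lemma invariant_probs_if_integrals_eq:
  assumes \<mu>: "\<mu> \<in> borel_probs"
    and eq: "\<And>w :: bseq \<Rightarrow> real. continuous_on UNIV w \<Longrightarrow> integral\<^sup>L \<mu> (\<lambda>x. w (shift x)) = integral\<^sup>L \<mu> w"
  shows "\<mu> \<in> invariant_probs"
proof -
  interpret prob_space \<mu> by (rule borel_probs_simps[OF \<mu>])
  note m = borel_probs_measurable[OF \<mu>]
  have sb: "distr \<mu> borel shift \<in> borel_probs"
    by (auto simp: borel_probs_def m intro!: prob_space_distr)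
  have "distr \<mu> borel shift = \<mu>"
  proof (rule cylinder_measure_eqI[OF sb \<mu>])
    fix L u
    let ?f = "indicator {x. trunc L x = u} :: bseq \<Rightarrow> real"
    have f: "continuous_on UNIV ?f"
      by (rule continuous_on_local[of _ L]) (simp add: indicator_def trunc_trunc)
    have "measure (distr \<mu> borel shift) {x. trunc L x = u} = integral\<^sup>L (distr \<mu> borel shift) ?f"
      by simp
    also have "\<dots> = integral\<^sup>L \<mu> (\<lambda>x. ?f (shift x))"
      by (intro integral_distr borel_measurable_continuous_onI f) (simp add: m)
    also have "\<dots> = measure \<mu> {x. trunc L x = u}"
      using eq[OF f] by (simp add: borel_probs_simps[OF \<mu>])
    finally show "measure (distr \<mu> borel shift) {x. trunc L x = u} = measure \<mu> {x. trunc L x = u}" .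
  qed
  then show ?thesis using \<mu> by (simp add: invariant_probs_def shift_invariant_def)
qed

section \<open>Passage to the weak* limit\<close>

theorem theorem16:
  fixes c :: "bseq \<times> bseq \<Rightarrow> real"
    and P :: "nat \<Rightarrow> bseq measure \<Rightarrow> bseq measure \<Rightarrow> (bseq \<times> bseq) measure"
    and \<beta> :: "nat \<Rightarrow> real" and n :: "nat \<Rightarrow> nat"
    and \<pi>_inf :: "(bseq \<times> bseq) measure"
  assumes "continuous_on UNIV c"
    and "\<And>m \<mu> \<nu>. 1 \<le> m \<Longrightarrow> \<mu> \<in> Fix m \<Longrightarrow> \<nu> \<in> Fix m \<Longrightarrow> maximizing_plan c \<mu> \<nu> (P m \<mu> \<nu>)"
    and "\<And>j. 0 < \<beta> j" and "\<And>j. 1 \<le> n j"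
    and "filterlim \<beta> at_top sequentially" and "filterlim n at_top sequentially"
    and "\<pi>_inf \<in> borel_probs"
    and "weak_star_tendsto (\<lambda>j. zeta c (P (n j)) (\<beta> j) (n j)) \<pi>_inf"
  shows "\<pi>_inf \<in> invariant_plans \<and>
    ((\<forall>z. 0 < c z) \<longrightarrow>
       (\<forall>\<pi>\<in>invariant_plans. integral\<^sup>L \<pi> c \<le> integral\<^sup>L \<pi>_inf c) \<and>
       integral\<^sup>L \<pi>_inf c = (SUP \<pi>\<in>invariant_plans. integral\<^sup>L \<pi> c))"
proof -
  note c = assms(1) and P = assms(2) and \<beta> = assms(3) and n = assms(4)
  let ?\<zeta> = "\<lambda>j. zeta c (P (n j)) (\<beta> j) (n j)"
  have lim: "(\<lambda>j. integral\<^sup>L (?\<zeta> j) w) \<longlonglongrightarrow> integral\<^sup>L \<pi>_inf w"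
    if "continuous_on UNIV w" for w :: "bseq \<times> bseq \<Rightarrow> real"
    using assms(8) that by (simp add: weak_star_tendsto_def)
  have Pp: "P (n j) \<mu> \<nu> \<in> plans \<mu> \<nu>" if "\<mu> \<in> Fix (n j)" "\<nu> \<in> Fix (n j)" for j \<mu> \<nu>
    using P[OF n that] by (simp add: maximizing_plan_def)
  \<comment> \<open>Stated for a general continuous \<open>f\<close> so that both projections are
    handled by one argument.\<close>
  have marginal: "distr \<pi>_inf borel f \<in> invariant_probs"
    if f: "continuous_on UNIV f"
      and inv: "\<And>(w :: bseq \<Rightarrow> real) j. continuous_on UNIV w \<Longrightarrow> (\<integral>x. w (shift (f x)) \<partial>?\<zeta> j) = (\<integral>x. w (f x) \<partial>?\<zeta> j)" for f
  proof (rule invariant_probs_if_integrals_eq)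
    interpret prob_space \<pi>_inf by (rule borel_probs_simps[OF assms(7)])
    have fm: "f \<in> borel_measurable \<pi>_inf"
      using borel_measurable_continuous_onI[OF f] by (simp add: borel_probs_measurable[OF assms(7)])
    then show "distr \<pi>_inf borel f \<in> borel_probs"
      by (auto simp: borel_probs_def intro!: prob_space_distr)
    fix w :: "bseq \<Rightarrow> real" assume w: "continuous_on UNIV w"
    have ws: "continuous_on UNIV (\<lambda>x. w (shift x))"
      using continuous_on_compose2[OF w continuous_on_shift] by simp
    have "continuous_on UNIV (\<lambda>x. w (f x))" "continuous_on UNIV (\<lambda>x. w (shift (f x)))"
      using continuous_on_compose2[OF w f] continuous_on_compose2[OF ws f] by auto
    from this[THEN lim] have "(\<integral>x. w (shift (f x)) \<partial>\<pi>_inf) = (\<integral>x. w (f x) \<partial>\<pi>_inf)"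
      unfolding inv[OF w] by (rule LIMSEQ_unique[rotated])
    then show "integral\<^sup>L (distr \<pi>_inf borel f) (\<lambda>x. w (shift x)) = integral\<^sup>L (distr \<pi>_inf borel f) w"
      using w ws by (simp add: integral_distr[OF fm] borel_measurable_continuous_onI)
  qed
  have inv: "\<pi>_inf \<in> invariant_plans"
    unfolding invariant_plans_def using assms(7) Pp n
    by (auto intro!: marginal continuous_on_fst continuous_on_snd continuous_on_id integral_zeta_shift)
  moreover have max: "integral\<^sup>L \<pi> c \<le> integral\<^sup>L \<pi>_inf c" if pos: "\<forall>z. 0 < c z" and \<pi>: "\<pi> \<in> invariant_plans" for \<pi>
  proof (rule field_le_epsilon)
    fix e :: real assume e: "e > 0"
    have "\<forall>\<^sub>F k in sequentially. \<exists>\<mu>\<in>Fix k. \<exists>\<nu>\<in>Fix k. \<exists>\<rho>\<in>plans \<mu> \<nu>. integral\<^sup>L \<pi> c - e \<le> integral\<^sup>L \<rho> c"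
      using plan_approximation[OF c _ \<pi> e] pos by blast
    \<comment> \<open>Plans close to \<open>\<pi>\<close> exist for all large periods, hence along
      \<open>n j\<close>, which tends to infinity.\<close>
    from eventually_compose_filterlim[OF this assms(6)]
    have "\<forall>\<^sub>F j in sequentially. integral\<^sup>L \<pi> c - e - ln 4 / \<beta> j \<le> integral\<^sup>L (?\<zeta> j) c"
    proof eventually_elim
      case (elim j)
      then obtain \<mu> \<nu> \<rho> where \<rho>: "\<mu> \<in> Fix (n j)" "\<nu> \<in> Fix (n j)" "\<rho> \<in> plans \<mu> \<nu>"
        "integral\<^sup>L \<pi> c - e \<le> integral\<^sup>L \<rho> c"
        by blast
      have "integral\<^sup>L \<rho> c - ln 4 / \<beta> j \<le> integral\<^sup>L (?\<zeta> j) c"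
        by (rule integral_zeta_lower_bound[OF c P[OF n] n \<beta> \<rho>(1-3)])
      with \<rho>(4) show ?case by linarith
    qed
    \<comment> \<open>With \<open>e\<close> fixed, the entropy cost vanishes because
      \<open>\<beta> j\<close> tends to infinity; \<open>e\<close> is sent to 0 only after the limit
      in \<open>j\<close>.\<close>
    moreover have "(\<lambda>j. integral\<^sup>L \<pi> c - e - ln 4 / \<beta> j) \<longlonglongrightarrow> integral\<^sup>L \<pi> c - e - 0"
      by (intro tendsto_intros real_tendsto_divide_at_top[OF tendsto_const assms(5)])
    ultimately have "integral\<^sup>L \<pi> c - e - 0 \<le> integral\<^sup>L \<pi>_inf c"
      using lim[OF c] by (intro tendsto_le[OF sequentially_bot]) auto
    then show "integral\<^sup>L \<pi> c \<le> integral\<^sup>L \<pi>_inf c + e" by simp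
  qed
  \<comment> \<open>The supremum is attained at \<open>\<pi>_inf\<close>, which itself has invariant
    marginals.\<close>
  moreover have "integral\<^sup>L \<pi>_inf c = (SUP \<pi>\<in>invariant_plans. integral\<^sup>L \<pi> c)" if "\<forall>z. 0 < c z"
    using inv max[OF that] by (intro cSup_eq_maximum[symmetric]) auto
  ultimately show ?thesis by blast
qed

end
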